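(* Let $t_0\in\mathbb{R}$, $T\in(\mathbb{R}\setminus\{t_0\})\cup\{\pm\infty\}$, let $\mathcal{P}$ be the open segment of the real axis between $t_0$ and $T$, and let $\phi:\mathcal{P}\to(0,\infty)$ and $a:\mathcal{P}\to\mathbb{C}$ be continuous. Suppose that $\phi(t)>\phi(t_0)\ge 0$ for every $t\in\mathcal{P}\cup\{T\}$, and that there is $\lambda_0\ge 0$ with $\int_{\mathcal{P}}e^{-\lambda_0\phi(t)}|a(t)|\,dt<\infty$. Suppose there exists a function $\varphi:\mathcal{P}\to(0,\infty)$ such that the pair $(a,\varphi)$ satisfies the factorization condition (F) and the pair $(\phi,\varphi)$ satisfies the kernel condition (K) with scale function $\Phi$ (both conditions are spelled out in the context). Then, with $\chi_n$, $\operatorname{c}_{\mathcal{P}}(n)$ and $\omega_{\mathcal{P}}$ as in the context, $$\int_{\mathcal{P}}e^{-\lambda\phi(t)}a(t)\,dt\;\sim\;e^{i\omega_{\mathcal{P}}}\sum_{n=0}^{\infty}\Phi(\chi_n,\lambda)\,\operatorname{c}_{\mathcal{P}}(n)\qquad(\lambda\to\infty).$$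
   Context: Conventions. Integrals over $\mathcal{P}$ are with respect to $dt$ on the real line. For a function $f$ on $\mathcal{P}$ and $\tau\in\{t_0,T\}$, $f(\tau)$ denotes $\lim_{t\to\tau,\,t\in\mathcal{P}}f(t)$ ($\phi(T)$ need not be finite). $\omega_{\mathcal{P}}:=0$ if $T>t_0$ and $\omega_{\mathcal{P}}:=\pi$ if $T<t_0$. $D_R(t_0)=\{t\in\mathbb{C}:|t-t_0|<R\}$ and $\mathcal{P}_R:=\mathcal{P}\cap D_R(t_0)$. Powers of the positive number $\varphi(t)$ are taken with $\arg\varphi(t)=0$. Condition (F). There exists $R>0$ with $\varphi(t)>0$ for $t\in\mathcal{P}_R$, and there exist $\alpha_0\in\mathbb{C}$ with $\Re\alpha_0>-1$, $\beta_0>0$, and analytic functions $q,p:D_R(t_0)\to\mathbb{C}$ with $p(t_0)\ne0$, such that $$a(t)=(t-t_0)^{\alpha_0}q(t),\qquad \varphi(t)=(t-t_0)^{\beta_0}p(t)\qquad(t\in\mathcal{P}_R\cup\{t_0\}),$$ where $(t-t_0)^{\gamma}=|t-t_0|^{\gamma}e^{i\gamma\omega_{\mathcal{P}}}$ for $t\in\mathcal{P}_R$, and at $t=t_0$ both sides are understood through the limit $t\to t_0$ along $\mathcal{P}$. Powers of $p$ use the branch with $\arg p(t)=-\beta_0\omega_{\mathcal{P}}$ for $t\in\mathcal{P}_R\cup\{t_0\}$, i.e. $\{p(t)\}^{\kappa}=|p(t)|^{\kappa}e^{-i\kappa\beta_0\omega_{\mathcal{P}}}$ there, continued analytically to a neighbourhood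 of $t_0$. Parameters and coefficients. For $n\in\mathbb{N}_0$, $$\chi_n:=\frac{\alpha_0+1+n}{\beta_0},\qquad \operatorname{c}_{\mathcal{P}}(n):=\frac{1}{\beta_0}\,\frac{1}{n!}\,\frac{d^n}{dw^n}\,\frac{q(w)}{\{p(w)\}^{\chi_n}}\Big|_{w=t_0}.$$ Condition (K). There are $\Phi:\mathbb{C}\times(0,\infty)\to\mathbb{C}$ and, for each $\lambda>0$, a number $\zeta_\lambda>0$, with $\zeta_\lambda\to\infty$ as $\lambda\to\infty$, such that: (i) for each $\lambda>0$, each $0<x_0<\zeta_\lambda$ and each $t\in\mathcal{P}$, $e^{-\lambda\phi(t)}=\frac{1}{2\pi i}\int_{x_0-i\infty}^{x_0+i\infty}\Phi(z,\lambda)\{\varphi(t)\}^{-z}dz$; (ii) for each fixed $\lambda>0$, $z\mapsto\Phi(z,\lambda)$ is holomorphic in the strip $0<\Re z<\zeta_\lambda$, and $\Phi(z,\lambda)=\mathcal{O}(|z|^{-2})$ as $\Im z\to\pm\infty$ in this strip; (iii) for fixed $z_1,z_2$ with $0<\Re z_1<\Re z_2<\zeta_\lambda$, $\Phi(z_2,\lambda)=o(\Phi(z_1,\lambda))$ as $\lambda\to\infty$; (iv) for each $x>0$, $\int_{-\infty}^{\infty}\frac{|\Phi(x+iy,\lambda)|}{|x+iy|}dy=\mathcal{O}(\Phi(x,\lambda))$ as $\lambda\to\infty$; (v) for each $c>0$ and all $z$ with $\Re z>0$, $e^{-c\lambda}=o(\Phi(z,\lambda))$ as $\lambda\to\infty$.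 Meaning of $\sim$: $L(\lambda)\sim\sum_{n\ge0}\Phi(\chi_n,\lambda)d_n$ means that for every $N\in\mathbb{N}$, $L(\lambda)-\sum_{n=0}^{N-1}\Phi(\chi_n,\lambda)d_n=o(\Phi(\chi_{N-1},\lambda))$ as $\lambda\to\infty$. *)

theory Defs
  imports "HOL-Complex_Analysis.Complex_Analysis" "HOL-Library.Landau_Symbols"
begin

definition segment :: "real \<Rightarrow> ereal \<Rightarrow> real set" where
  "segment t0 T = einterval (min (ereal t0) T) (max (ereal t0) T)"

definition segment_arg :: "real \<Rightarrow> ereal \<Rightarrow> real" where
  "segment_arg t0 T = (if T > ereal t0 then 0 else pi)"

text \<open>The power \<open>(t - t0)\<close> to the exponent \<open>\<gamma>\<close> for \<open>t\<close> on the segment, with the argument of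
  \<open>t - t0\<close> taken to be \<open>segment_arg t0 T\<close>.\<close>

definition segment_power :: "real \<Rightarrow> ereal \<Rightarrow> complex \<Rightarrow> real \<Rightarrow> complex" where
  "segment_power t0 T \<gamma> t =
     complex_of_real \<bar>t - t0\<bar> powr \<gamma> * exp (\<i> * \<gamma> * of_real (segment_arg t0 T))"

text \<open>The factorizations are required on the open segment near \<open>t0\<close>. At \<open>t0\<close> itself they are to be
  read through the limit along the segment, which adds nothing: two functions that coincide on the
  segment have the same limiting behaviour.\<close>

definition factorization_condition ::
  "real \<Rightarrow> ereal \<Rightarrow> (real \<Rightarrow> complex) \<Rightarrow> (real \<Rightarrow> real) \<Rightarrow> real \<Rightarrow> complex \<Rightarrow> real \<Rightarrow>
    (complex \<Rightarrow> complex) \<Rightarrow> (complex \<Rightarrow> complex) \<Rightarrow> bool" where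
  "factorization_condition t0 T a \<psi> R \<alpha> \<beta> q p \<longleftrightarrow>
     R > 0 \<and> (\<forall>t \<in> segment t0 T \<inter> ball t0 R. \<psi> t > 0) \<and>
     Re \<alpha> > -1 \<and> \<beta> > 0 \<and>
     q analytic_on ball (of_real t0) R \<and> p analytic_on ball (of_real t0) R \<and>
     p (of_real t0) \<noteq> 0 \<and>
     (\<forall>t \<in> segment t0 T \<inter> ball t0 R.
        a t = segment_power t0 T \<alpha> t * q (of_real t) \<and>
        of_real (\<psi> t) = segment_power t0 T (of_real \<beta>) t * p (of_real t))"

text \<open>The branch of the power of \<open>p\<close> that is analytic at \<open>t0\<close> and has
  \<open>arg p(t) = - \<beta> * segment_arg t0 T\<close> on the segment: near \<open>t0\<close> the logarithm of \<open>p\<close> is the principal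
  logarithm of \<open>p w / p t0\<close> plus the prescribed logarithm of \<open>p t0\<close>. The lemmas
  \<open>branch_power_analytic\<close>, \<open>branch_power_on_segment\<close> and \<open>branch_power_unique\<close> below show that this
  is exactly the analytic continuation of the values prescribed on the segment.\<close>

definition branch_power ::
  "real \<Rightarrow> ereal \<Rightarrow> real \<Rightarrow> (complex \<Rightarrow> complex) \<Rightarrow> complex \<Rightarrow> complex \<Rightarrow> complex" where
  "branch_power t0 T \<beta> p \<kappa> w =
     exp (\<kappa> * (Ln (p w / p (of_real t0)) + of_real (ln (cmod (p (of_real t0))))
               - \<i> * of_real (\<beta> * segment_arg t0 T)))"

definition chi_exponent :: "complex \<Rightarrow> real \<Rightarrow> nat \<Rightarrow> complex" where
  "chi_exponent \<alpha> \<beta> n = (\<alpha> + 1 + of_nat n) / of_real \<beta>"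

definition segment_coeff ::
  "real \<Rightarrow> ereal \<Rightarrow> complex \<Rightarrow> real \<Rightarrow> (complex \<Rightarrow> complex) \<Rightarrow> (complex \<Rightarrow> complex) \<Rightarrow> nat \<Rightarrow> complex"
  where
  "segment_coeff t0 T \<alpha> \<beta> q p n =
     1 / of_real \<beta> * (1 / fact n) *
     (deriv ^^ n) (\<lambda>w. q w / branch_power t0 T \<beta> p (chi_exponent \<alpha> \<beta> n) w) (of_real t0)"

text \<open>The integral of \<open>f\<close> along the vertical line from \<open>x - \<i>\<infinity>\<close> to \<open>x + \<i>\<infinity>\<close>, parametrized by
  \<open>z = x + \<i>y\<close>, \<open>dz = \<i> dy\<close>.\<close>

definition vertical_line_integral :: "real \<Rightarrow> (complex \<Rightarrow> complex) \<Rightarrow> complex" where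
  "vertical_line_integral x f = (LINT y|lborel. f (Complex x y) * \<i>)"

definition vertical_strip :: "real \<Rightarrow> real \<Rightarrow> complex set" where
  "vertical_strip b c = {z. b < Re z \<and> Re z < c}"

text \<open>The filter describing \<open>Im z\<close> tending to plus or minus infinity, uniformly over the strip.\<close>

definition strip_ends :: "real \<Rightarrow> real \<Rightarrow> complex filter" where
  "strip_ends b c = inf (filtercomap (\<lambda>z. \<bar>Im z\<bar>) at_top) (principal (vertical_strip b c))"

text \<open>In the third clause the proviso \<open>Re z2 < \<zeta> l\<close> is omitted since it holds for all large \<open>l\<close>.
  In the Landau symbols the numbers \<open>exp (- c l)\<close> etc. are only embedded into the complex
  numbers because both arguments have to have the same type.\<close>

definition kernel_condition ::
  "real set \<Rightarrow> (real \<Rightarrow> real) \<Rightarrow> (real \<Rightarrow> real) \<Rightarrow> (complex \<Rightarrow> real \<Rightarrow> complex) \<Rightarrow> bool" where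
  "kernel_condition P \<phi> \<psi> \<Phi> \<longleftrightarrow>
     (\<exists>\<zeta> :: real \<Rightarrow> real.
        (\<forall>l>0. \<zeta> l > 0) \<and> filterlim \<zeta> at_top at_top \<and>
        (\<forall>l>0. \<forall>x. 0 < x \<and> x < \<zeta> l \<longrightarrow> (\<forall>t\<in>P.
           exp (- of_real (l * \<phi> t)) =
             1 / (2 * of_real pi * \<i>) *
             vertical_line_integral x (\<lambda>z. \<Phi> z l * of_real (\<psi> t) powr (- z)))) \<and>
        (\<forall>l>0. (\<lambda>z. \<Phi> z l) holomorphic_on vertical_strip 0 (\<zeta> l) \<and>
           (\<lambda>z. \<Phi> z l) \<in>
             O[strip_ends 0 (\<zeta> l)](\<lambda>z. of_real (1 / (cmod z)\<^sup>2))) \<and>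
        (\<forall>z1 z2. 0 < Re z1 \<and> Re z1 < Re z2 \<longrightarrow> (\<lambda>l. \<Phi> z2 l) \<in> o[at_top](\<lambda>l. \<Phi> z1 l)) \<and>
        (\<forall>x>0. (\<lambda>l. of_real (LINT y|lborel. cmod (\<Phi> (Complex x y) l) / cmod (Complex x y)))
           \<in> O[at_top](\<lambda>l. \<Phi> (of_real x) l)) \<and>
        (\<forall>c>0. \<forall>z. Re z > 0 \<longrightarrow>
           (\<lambda>l. of_real (exp (- c * l))) \<in> o[at_top](\<lambda>l. \<Phi> z l)))"

text \<open>The expansion of \<open>L\<close> as \<open>l\<close> tends to infinity in the scale of the functions \<open>\<Phi> (\<chi> n) l\<close> with
  coefficients \<open>d n\<close>.\<close>

definition scale_expansion ::
  "(real \<Rightarrow> complex) \<Rightarrow> (complex \<Rightarrow> real \<Rightarrow> complex) \<Rightarrow> (nat \<Rightarrow> complex) \<Rightarrow> (nat \<Rightarrow> complex) \<Rightarrow> bool"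
  where
  "scale_expansion L \<Phi> e d \<longleftrightarrow>
     (\<forall>N\<ge>1. (\<lambda>l. L l - (\<Sum>n<N. \<Phi> (e n) l * d n)) \<in> o[at_top](\<lambda>l. \<Phi> (e (N - 1)) l))"

lemma at_within_segment_nontrivial:
  assumes "T \<noteq> ereal t0"
  shows "at t0 within segment t0 T \<noteq> bot"
proof (cases "T > ereal t0")
  case True
  then obtain s where s: "ereal t0 < ereal s" "ereal s < T"
    using ereal_dense2 by blast
  have "{t0<..<s} \<subseteq> segment t0 T"
  proof
    fix x assume x: "x \<in> {t0<..<s}"
    have "ereal x < T" using x s(2) by (auto intro: less_trans[of _ "ereal s"])
    then show "x \<in> segment t0 T"
      using x True by (auto simp: segment_def einterval_def min_def max_def)
  qed
  moreover have "at t0 within {t0<..<s} \<noteq> bot"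
    using s by (simp add: islimpt_greaterThanLessThan1 trivial_limit_within)
  ultimately show ?thesis
    using at_le[of _ "segment t0 T" t0] by (metis bot.extremum_uniqueI)
next
  case False
  then have "T < ereal t0" using assms by auto
  then obtain s where s: "T < ereal s" "ereal s < ereal t0"
    using ereal_dense2 by blast
  have "{s<..<t0} \<subseteq> segment t0 T"
  proof
    fix x assume x: "x \<in> {s<..<t0}"
    have "T < ereal x" using x s(1) by (auto intro: less_trans[of _ "ereal s"])
    then show "x \<in> segment t0 T"
      using x \<open>T < ereal t0\<close> by (auto simp: segment_def einterval_def min_def max_def)
  qed
  moreover have "at t0 within {s<..<t0} \<noteq> bot"
    using s by (simp add: islimpt_greaterThanLessThan2 trivial_limit_within)
  ultimately show ?thesis
    using at_le[of _ "segment t0 T" t0] by (metis bot.extremum_uniqueI)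
qed

lemma factorization_arg:
  assumes F: "factorization_condition t0 T a \<psi> R \<alpha> \<beta> q p" and T: "T \<noteq> ereal t0"
    and t: "t \<in> (segment t0 T \<inter> ball t0 R) \<union> {t0}"
  shows "p (of_real t) = of_real (cmod (p (of_real t))) * exp (- \<i> * of_real (\<beta> * segment_arg t0 T))"
    and "p (of_real t) \<noteq> 0"
proof -
  define E where "E = exp (\<i> * of_real (\<beta> * segment_arg t0 T))"
  have E0: "E \<noteq> 0" and nE: "cmod E = 1"
    by (simp_all add: E_def)
  have iE: "exp (- \<i> * of_real (\<beta> * segment_arg t0 T)) = inverse E"
    by (simp add: E_def exp_minus)
  have R: "R > 0" and p_an: "p analytic_on ball (of_real t0) R" and p0: "p (of_real t0) \<noteq> 0"
    using F by (auto simp: factorization_condition_def)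
  have pos: "\<exists>r>0. p (of_real t) * E = of_real r" if "t \<in> segment t0 T \<inter> ball t0 R" for t
  proof -
    have t0: "t \<noteq> t0"
      using that by (auto simp: segment_def einterval_def min_def max_def split: if_splits)
    have \<psi>: "\<psi> t > 0" "of_real (\<psi> t) = segment_power t0 T (of_real \<beta>) t * p (of_real t)"
      using F that by (auto simp: factorization_condition_def)
    have "segment_power t0 T (of_real \<beta>) t = of_real (\<bar>t - t0\<bar> powr \<beta>) * E"
      by (simp add: segment_power_def E_def powr_of_real mult_ac)
    then have "p (of_real t) * E = of_real (\<psi> t / \<bar>t - t0\<bar> powr \<beta>)"
      using \<psi> t0 by (simp add: field_simps)
    moreover have "\<psi> t / \<bar>t - t0\<bar> powr \<beta> > 0"
      using \<psi> t0 by simp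
    ultimately show ?thesis by blast
  qed
  define K where "K = {z::complex. Im z = 0 \<and> Re z \<ge> 0}"
  have posK: "p (of_real t) * E \<in> K" if "t \<in> segment t0 T \<inter> ball t0 R" for t
  proof -
    from pos[OF that] obtain r where "r > 0" "p (of_real t) * E = of_real r"
      by blast
    then show ?thesis by (simp add: K_def)
  qed
  have K: "closed K"
    unfolding K_def by (intro closed_Collect_conj closed_Collect_eq closed_Collect_le continuous_intros)
  have "isCont p (of_real t0)"
    using p_an R by (meson analytic_at_imp_isCont analytic_on_analytic_at centre_in_ball)
  then have "isCont (\<lambda>s::real. p (of_real s)) t0"
    by (rule isCont_o2[rotated]) simp
  then have "((\<lambda>s::real. p (of_real s)) \<longlongrightarrow> p (of_real t0)) (at t0 within segment t0 T)"
    unfolding isCont_def by (rule tendsto_within_subset) simp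
  then have lim: "((\<lambda>s::real. p (of_real s) * E) \<longlongrightarrow> p (of_real t0) * E) (at t0 within segment t0 T)"
    by (rule tendsto_mult_right)
  have "eventually (\<lambda>s. s \<in> segment t0 T \<inter> ball t0 R) (at t0 within segment t0 T)"
    using R by (auto simp: eventually_at dist_commute intro!: exI[of _ R])
  then have "eventually (\<lambda>s. p (of_real s) * E \<in> K) (at t0 within segment t0 T)"
    by (rule eventually_mono) (rule posK)
  then have "p (of_real t0) * E \<in> K"
    using Lim_in_closed_set[OF K _ at_within_segment_nontrivial[OF T] lim] by blast
  then have inK: "p (of_real t) * E \<in> K"
    using t posK by blast
  show "p (of_real t) \<noteq> 0"
    using t pos p0 by force
  have "p (of_real t) * E = of_real (cmod (p (of_real t) * E))"
    using inK by (auto simp: K_def complex_eq_iff cmod_eq_Re)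
  also have "\<dots> = of_real (cmod (p (of_real t)))"
    by (simp add: norm_mult nE)
  finally show "p (of_real t) =
      of_real (cmod (p (of_real t))) * exp (- \<i> * of_real (\<beta> * segment_arg t0 T))"
    unfolding iE using E0 by (simp add: field_simps)
qed

lemma branch_power_on_segment:
  assumes F: "factorization_condition t0 T a \<psi> R \<alpha> \<beta> q p" and T: "T \<noteq> ereal t0"
    and t: "t \<in> (segment t0 T \<inter> ball t0 R) \<union> {t0}"
  shows "branch_power t0 T \<beta> p \<kappa> (of_real t) =
    of_real (cmod (p (of_real t))) powr \<kappa> * exp (- \<i> * \<kappa> * of_real (\<beta> * segment_arg t0 T))"
proof -
  define r r0 where "r = cmod (p (of_real t))" and "r0 = cmod (p (of_real t0))"
  define E where "E = exp (- \<i> * of_real (\<beta> * segment_arg t0 T))"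
  have r: "r > 0" "p (of_real t) = of_real r * E"
    using factorization_arg[OF F T t] by (auto simp: r_def E_def)
  have r0: "r0 > 0" "p (of_real t0) = of_real r0 * E"
    using factorization_arg[OF F T, of t0] by (auto simp: r0_def E_def)
  have "p (of_real t) / p (of_real t0) = of_real (r / r0)"
    using r r0 by (simp add: E_def)
  then have "Ln (p (of_real t) / p (of_real t0)) = of_real (ln r - ln r0)"
    using r(1) r0(1) by (simp only: Ln_of_real divide_pos_pos) (simp add: ln_div)
  then have "branch_power t0 T \<beta> p \<kappa> (of_real t) =
      exp (\<kappa> * (of_real (ln r) - \<i> * of_real (\<beta> * segment_arg t0 T)))"
    by (simp add: branch_power_def flip: r0_def)
  also have "\<dots> = of_real r powr \<kappa> * exp (- \<i> * \<kappa> * of_real (\<beta> * segment_arg t0 T))"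
    using r(1) by (simp add: powr_def Ln_of_real algebra_simps flip: exp_add)
  finally show ?thesis by (simp add: r_def)
qed

lemma branch_power_analytic:
  assumes F: "factorization_condition t0 T a \<psi> R \<alpha> \<beta> q p"
  shows "branch_power t0 T \<beta> p \<kappa> analytic_on {of_real t0}"
proof -
  have "p analytic_on {of_real t0}" and p0: "p (of_real t0) \<noteq> 0"
    using F by (auto simp: factorization_condition_def elim: analytic_on_subset)
  then show ?thesis
    unfolding branch_power_def by (intro analytic_intros) auto
qed

lemma branch_power_unique:
  assumes F: "factorization_condition t0 T a \<psi> R \<alpha> \<beta> q p" and T: "T \<noteq> ereal t0"
    and g: "g analytic_on {of_real t0}"
    and g_eq: "eventually (\<lambda>t. g (of_real t) = of_real (cmod (p (of_real t))) powr \<kappa> *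
        exp (- \<i> * \<kappa> * of_real (\<beta> * segment_arg t0 T))) (at t0 within segment t0 T)"
  shows "eventually (\<lambda>w. g w = branch_power t0 T \<beta> p \<kappa> w) (nhds (of_real t0))"
proof -
  let ?b = "branch_power t0 T \<beta> p \<kappa>"
  have R: "R > 0" using F by (auto simp: factorization_condition_def)
  have an: "(\<lambda>w. g w - ?b w) analytic_on {of_real t0}"
    by (intro analytic_on_diff g branch_power_analytic[OF F])
  have near: "eventually (\<lambda>s. s \<in> segment t0 T \<inter> ball t0 R) (at t0 within segment t0 T)"
    using R by (auto simp: eventually_at dist_commute intro!: exI[of _ R])
  have zero: "eventually (\<lambda>t. g (of_real t) - ?b (of_real t) = 0) (at t0 within segment t0 T)"
    using g_eq near by eventually_elim (use branch_power_on_segment[OF F T] in simp)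
  have of_real_lim: "filterlim (of_real :: real \<Rightarrow> complex) (at (of_real t0)) (at t0 within segment t0 T)"
    by (auto simp: filterlim_at eventually_at_filter intro!: tendsto_intros)
  have "frequently (\<lambda>w. g w - ?b w = 0) (at (of_real t0))"
  proof (rule ccontr)
    assume "\<not> ?thesis"
    then have "eventually (\<lambda>w. g w - ?b w \<noteq> 0) (at (of_real t0))"
      by (simp add: frequently_def)
    then have "eventually (\<lambda>t. g (of_real t) - ?b (of_real t) \<noteq> 0) (at t0 within segment t0 T)"
      using of_real_lim by (auto simp: filterlim_iff)
    with zero have "eventually (\<lambda>_. False) (at t0 within segment t0 T)"
      by eventually_elim simp
    then show False
      using at_within_segment_nontrivial[OF T] by (simp add: eventually_False)
  qed
  then have ev: "eventually (\<lambda>w. g w - ?b w = 0) (at (of_real t0))"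
    using an by (intro not_essential_frequently_0_imp_eventually_0
        isolated_singularity_at_analytic not_essential_analytic)
  have "isCont (\<lambda>w. g w - ?b w) (of_real t0)"
    using an by (rule analytic_at_imp_isCont)
  then have "((\<lambda>w. g w - ?b w) \<longlongrightarrow> g (of_real t0) - ?b (of_real t0)) (at (of_real t0))"
    by (simp add: isCont_def)
  moreover have "((\<lambda>w. g w - ?b w) \<longlongrightarrow> 0) (at (of_real t0))"
    using ev by (rule tendsto_eventually)
  ultimately have "g (of_real t0) - ?b (of_real t0) = 0"
    using LIM_unique by blast
  with ev have "eventually (\<lambda>w. g w - ?b w = 0) (nhds (of_real t0))"
    by (simp add: eventually_nhds_conv_at)
  then show ?thesis by simp
qed

end

theory Submission
  imports Defs "HOL-Probability.Sinc_Integral"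
begin

text \<open>
  The kernel condition writes \<open>exp (- l * \<phi> t)\<close> as an inverse Mellin transform
  \<open>1 / (2 \<pi> \<i>) \<integral> \<Phi> z l * \<psi> t powr (- z) dz\<close> along any vertical line \<open>Re z = x\<close> inside a strip that grows
  with \<open>l\<close>. Put this into the integral over a short interval at \<open>t0\<close> and exchange the order of
  integration: what remains is the line integral of \<open>\<Phi> z l\<close> against the Mellin transform
  of \<open>a\<close> with respect to \<open>\<psi>\<close>, and its size is governed by the position of the line. By the
  line estimate in the kernel condition it is \<open>O(\<Phi> x l)\<close> as soon as the Mellin transform is \<open>O(1 / \<bar>z\<bar>)\<close>,
  so that lines further to the right give smaller contributions. The terms of the expansion
  are the residues that are met when the line is moved to the right.

  To make the Mellin transform explicit, use the coordinate \<open>v = \<psi> powr (1 / \<beta>)\<close>. It is the restriction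
  to the segment of the function \<open>V w = (w - t0) * p w powr (1 / \<beta>)\<close>, which is conformal at \<open>t0\<close>; and
  \<open>a dt = v powr \<alpha> * (Q / V') dv\<close> with \<open>Q = q / p powr (\<alpha> / \<beta>)\<close>. Expanding \<open>Q / V'\<close> in powers of \<open>V\<close>
  (\<open>Lagrange_expansion\<close>) gives the coefficients
  \<open>(Q / p powr ((n + 1) / \<beta>))\<^sup>(\<^sup>n\<^sup>) (t0) / n!\<close>, which are \<open>\<beta>\<close> times the coefficients of the theorem
  because the exponents of \<open>p\<close> add up to \<open>\<chi>\<^sub>n = (\<alpha> + 1 + n) / \<beta>\<close>. All branches are handled by
  \<open>local_phase_coordinate\<close>, which also treats both directions of the segment at once: with
  \<open>\<sigma> = exp (\<i> \<omega>) = \<plusminus>1\<close> the segment is run through by \<open>t0 + \<sigma> * s\<close> for \<open>s > 0\<close>.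

  For the \<open>n\<close>-th power the Mellin transform is \<open>v h powr (\<beta> * (\<chi>\<^sub>n - z)) / (\<beta> * (\<chi>\<^sub>n - z))\<close>, where \<open>h\<close> is the
  length of the short interval. It has a single simple pole, and Cauchy's formula on long rectangles
  (\<open>vertical_line_shift\<close>) moves the line from the left of \<open>\<chi>\<^sub>n\<close> to a fixed line with
  \<open>Re \<chi>\<^sub>N\<^sub>-\<^sub>1 < x < Re \<chi>\<^sub>N\<close> at the price of the term \<open>\<Phi> \<chi>\<^sub>n l / \<beta>\<close> (\<open>power_integral_expansion\<close>). The
  remainder of the expansion vanishes to the order \<open>N\<close> at \<open>v = 0\<close>, so that the representation on that same
  line applies to it directly and no shift is needed; an integration by parts bounds its Mellin transform
  (\<open>remainder_integral_bound\<close>). Everything left over on the line is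
  \<open>O(\<Phi> x l) = o(\<Phi> \<chi>\<^sub>N\<^sub>-\<^sub>1 l)\<close>.

  Away from \<open>t0\<close> the phase stays above some \<open>c > \<phi> t0\<close>, by compactness (\<open>phase_gap\<close>). That part of the
  integral is \<open>O(exp (- c * l))\<close>, which the kernel condition makes negligible.
\<close>


section \<open>Expansion in powers of a local coordinate\<close>

text \<open>The quotient has a removable singularity at \<open>c\<close>. With \<open>V w = (w - c) * B w\<close> this is one step of an
  expansion in powers of \<open>V\<close>.\<close>

lemma divided_difference_holomorphic:
  assumes S: "open S" "c \<in> S" and F: "F holomorphic_on S" and B: "B holomorphic_on S"
    and B0: "\<And>w. w \<in> S \<Longrightarrow> B w \<noteq> 0"
  shows "\<exists>G. G holomorphic_on S \<and> (\<forall>w\<in>S. F w = F c + (w - c) * B w * G w)"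
proof -
  define g where "g w = (F w - F c) / B w" for w
  have g: "g holomorphic_on S"
    unfolding g_def by (intro holomorphic_intros F B B0)
  define G where "G w = (if w = c then deriv g c else g w / (w - c))" for w
  have "G holomorphic_on S"
    by (rule pole_theorem_open_0[OF g S(1), of c]) (auto simp: G_def g_def)
  moreover have "F w = F c + (w - c) * B w * G w" if "w \<in> S" for w
    using B0[OF that] by (auto simp: G_def g_def)
  ultimately show ?thesis by blast
qed

text \<open>The expansion of \<open>Q / V'\<close> in powers of \<open>V\<close>, with Lagrange's formula for the coefficients. Repeated
  divided differences produce some expansion; its \<open>N\<close>-th coefficient is found by integrating
  \<open>Q / V ^ (N + 1)\<close> over a small circle. There \<open>V' * V ^ n / V ^ (N + 1)\<close> has a primitive for
  \<open>n < N\<close>, the logarithmic derivative \<open>V' / V = 1 / (w - c) + B' / B\<close> contributes \<open>2 \<pi> \<i>\<close>, and the rest is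
  holomorphic; Cauchy's formula for the derivatives evaluates the same integral.\<close>

lemma Lagrange_expansion:
  fixes Q B :: "complex \<Rightarrow> complex"
  assumes r: "r > 0" and Q: "Q holomorphic_on ball c r" and B: "B holomorphic_on ball c r"
    and B0: "\<And>w. w \<in> ball c r \<Longrightarrow> B w \<noteq> 0"
  defines "V \<equiv> \<lambda>w. (w - c) * B w"
  assumes V'0: "\<And>w. w \<in> ball c r \<Longrightarrow> deriv V w \<noteq> 0"
  shows "\<exists>K. K holomorphic_on ball c r \<and> (\<forall>w\<in>ball c r.
    Q w = deriv V w * ((\<Sum>n<N. (deriv ^^ n) (\<lambda>w. Q w / B w ^ (n + 1)) c / fact n * V w ^ n)
            + V w ^ N * K w))"
proof (induction N)
  case 0
  have V: "V holomorphic_on ball c r"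
    unfolding V_def by (intro holomorphic_intros B)
  show ?case
    by (intro exI[of _ "\<lambda>w. Q w / deriv V w"])
      (use V'0 in \<open>auto intro!: holomorphic_intros Q holomorphic_deriv[OF V]\<close>)
next
  case (Suc N)
  define h where "h n = (deriv ^^ n) (\<lambda>w. Q w / B w ^ (n + 1)) c / fact n" for n
  have V: "V holomorphic_on ball c r"
    unfolding V_def by (intro holomorphic_intros B)
  have V': "deriv V holomorphic_on ball c r"
    by (rule holomorphic_deriv[OF V]) simp
  obtain F where F: "F holomorphic_on ball c r"
    and QF: "\<And>w. w \<in> ball c r \<Longrightarrow> Q w = deriv V w * ((\<Sum>n<N. h n * V w ^ n) + V w ^ N * F w)"
    using Suc.IH by (auto simp: h_def)
  obtain G where G: "G holomorphic_on ball c r"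
    and FG: "\<And>w. w \<in> ball c r \<Longrightarrow> F w = F c + V w * G w"
    using divided_difference_holomorphic[OF open_ball centre_in_ball[THEN iffD2, OF r] F B B0]
    unfolding V_def by metis
  define \<rho> where "\<rho> = r / 2"
  have \<rho>: "0 < \<rho>" "\<rho> < r" using r by (auto simp: \<rho>_def)
  have circ: "path_image (circlepath c \<rho>) \<subseteq> ball c r - {c}"
    using \<rho> by (auto simp: dist_norm norm_minus_commute)
  have Vn0: "V w \<noteq> 0" if "w \<in> ball c r - {c}" for w
    using that B0 by (auto simp: V_def)
  have sub: "cball c \<rho> \<subseteq> ball c r" "ball c \<rho> \<subseteq> ball c r"
    using \<rho> by auto
  have "((\<lambda>w. (Q w / B w ^ (N + 1)) / (w - c) ^ Suc N)
      has_contour_integral (2 * pi * \<i>) / fact N * (deriv ^^ N) (\<lambda>w. Q w / B w ^ (N + 1)) c)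
      (circlepath c \<rho>)"
    by (rule Cauchy_has_contour_integral_higher_derivative_circlepath)
      (use B0 sub \<rho> in \<open>auto intro!: holomorphic_on_imp_continuous_on holomorphic_intros
          intro: holomorphic_on_subset[OF Q] holomorphic_on_subset[OF B]\<close>)
  also have "(2 * pi * \<i>) / fact N * (deriv ^^ N) (\<lambda>w. Q w / B w ^ (N + 1)) c = 2 * pi * \<i> * h N"
    by (simp add: h_def)
  finally have "((\<lambda>w. Q w / V w ^ (N + 1)) has_contour_integral 2 * pi * \<i> * h N) (circlepath c \<rho>)"
    by (simp add: V_def power_mult_distrib mult_ac)
  moreover have "((\<lambda>w. Q w / V w ^ (N + 1)) has_contour_integral 2 * pi * \<i> * F c) (circlepath c \<rho>)"
  proof -
    \<comment> \<open>the lower terms are derivatives of negative powers of \<open>V\<close>\<close>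
    have lower: "((\<lambda>w. deriv V w * (h n * V w ^ n) / V w ^ (N + 1)) has_contour_integral 0)
        (circlepath c \<rho>)" if "n < N" for n
    proof -
      define m where "m = N - n"
      have m: "m > 0" "N + 1 = n + Suc m" using that by (auto simp: m_def)
      obtain j where j: "m = Suc j" using m(1) by (cases m) auto
      have "((\<lambda>w. - (h n / of_nat m) * inverse (V w) ^ m) has_field_derivative
           deriv V w * (h n * V w ^ n) / V w ^ (N + 1)) (at w within ball c r - {c})"
        if w: "w \<in> ball c r - {c}" for w
      proof -
        have "(V has_field_derivative deriv V w) (at w within ball c r - {c})"
          using w V by (auto intro!: holomorphic_derivI[of _ "ball c r"])
        from DERIV_cmult[OF DERIV_power[OF DERIV_inverse'[OF this Vn0[OF w]], of m], of "- (h n / of_nat m)"]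
        have "((\<lambda>w. - (h n / of_nat m) * inverse (V w) ^ m) has_field_derivative
            - (h n / of_nat m) * (of_nat m * (- (inverse (V w) * deriv V w * inverse (V w)) *
                inverse (V w) ^ j))) (at w within ball c r - {c})"
          by (simp add: j)
        also have "- (h n / of_nat m) * (of_nat m * (- (inverse (V w) * deriv V w * inverse (V w)) *
              inverse (V w) ^ j)) =
            deriv V w * (h n * V w ^ n) / V w ^ (N + 1)"
          unfolding m(2) j power_add using Vn0[OF w] by (simp add: field_simps del: of_nat_Suc)
        finally show ?thesis .
      qed
      from contour_integral_primitive[OF this, of "circlepath c \<rho>"] circ
      show ?thesis by simp
    qed
    have "((\<lambda>w. deriv V w / V w) has_contour_integral 2 * pi * \<i>) (circlepath c \<rho>)"
    proof -
      have "((\<lambda>w. 1 / (w - c)) has_contour_integral 2 * pi * \<i> * 1) (circlepath c \<rho>)"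
        using Cauchy_integral_circlepath_simple[of "\<lambda>_. 1" c \<rho> c] \<rho> by simp
      moreover have "((\<lambda>w. deriv B w / B w) has_contour_integral 0) (circlepath c \<rho>)"
        by (rule Cauchy_theorem_convex_simple[of _ "ball c r"])
          (use B0 circ in \<open>auto intro!: holomorphic_intros B holomorphic_deriv[OF B]\<close>)
      ultimately have "((\<lambda>w. 1 / (w - c) + deriv B w / B w) has_contour_integral 2 * pi * \<i> * 1 + 0)
          (circlepath c \<rho>)"
        by (rule has_contour_integral_add)
      then have "((\<lambda>w. 1 / (w - c) + deriv B w / B w) has_contour_integral 2 * pi * \<i>)
          (circlepath c \<rho>)" by simp
      moreover have "1 / (w - c) + deriv B w / B w = deriv V w / V w"
        if "w \<in> path_image (circlepath c \<rho>)" for w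
      proof -
        have w: "w \<in> ball c r" "w \<noteq> c" using that circ by auto
        have "(B has_field_derivative deriv B w) (at w)"
          using w B by (intro holomorphic_derivI[of _ "ball c r"]) auto
        then have "(V has_field_derivative B w + (w - c) * deriv B w) (at w)"
          unfolding V_def by (auto intro!: derivative_eq_intros)
        then have "deriv V w = B w + (w - c) * deriv B w" by (rule DERIV_imp_deriv)
        then show ?thesis using w B0[OF w(1)] by (simp add: V_def field_simps)
      qed
      ultimately show ?thesis by (rule has_contour_integral_eq)
    qed
    then have mid: "((\<lambda>w. F c * (deriv V w / V w)) has_contour_integral F c * (2 * pi * \<i>))
        (circlepath c \<rho>)" by (rule has_contour_integral_lmul)
    have rest: "((\<lambda>w. deriv V w * G w) has_contour_integral 0) (circlepath c \<rho>)"
      by (rule Cauchy_theorem_convex_simple[of _ "ball c r"])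
        (use circ in \<open>auto intro!: holomorphic_intros V' G\<close>)
    have "((\<lambda>w. (\<Sum>n<N. deriv V w * (h n * V w ^ n) / V w ^ (N + 1)) +
            (F c * (deriv V w / V w) + deriv V w * G w))
        has_contour_integral (\<Sum>n<N. 0) + (F c * (2 * pi * \<i>) + 0)) (circlepath c \<rho>)"
      by (intro has_contour_integral_add has_contour_integral_sum mid rest lower) auto
    then have "((\<lambda>w. (\<Sum>n<N. deriv V w * (h n * V w ^ n) / V w ^ (N + 1)) +
            (F c * (deriv V w / V w) + deriv V w * G w))
        has_contour_integral 2 * pi * \<i> * F c) (circlepath c \<rho>)"
      by (simp add: mult_ac)
    moreover have "(\<Sum>n<N. deriv V w * (h n * V w ^ n) / V w ^ (N + 1)) +
            (F c * (deriv V w / V w) + deriv V w * G w) = Q w / V w ^ (N + 1)"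
      if "w \<in> path_image (circlepath c \<rho>)" for w
    proof -
      have w: "w \<in> ball c r" "V w \<noteq> 0" using that circ Vn0 by blast+
      show ?thesis
        unfolding QF[OF w(1)] FG[OF w(1)] using w(2)
        by (simp add: sum_distrib_left sum_divide_distrib field_simps)
    qed
    ultimately show ?thesis by (rule has_contour_integral_eq)
  qed
  ultimately have "2 * pi * \<i> * h N = 2 * pi * \<i> * F c"
    by (rule has_contour_integral_unique)
  then have hN: "F c = h N" by simp
  have "Q w = deriv V w * ((\<Sum>n<Suc N. h n * V w ^ n) + V w ^ Suc N * G w)"
    if "w \<in> ball c r" for w
    unfolding QF[OF that] FG[OF that] hN by (simp add: algebra_simps)
  then show ?case using G by (auto simp: h_def)
qed

section \<open>Integrals along vertical lines\<close>

text \<open>Compare with \<open>1 / (1 + y\<^sup>2)\<close>; on the compact part \<open>\<bar>y\<bar> \<le> Y\<close> continuity suffices.\<close>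

lemma integrable_vertical_line_decay:
  fixes g :: "real \<Rightarrow> complex"
  assumes cont: "continuous_on UNIV g" and decay: "\<And>y. \<bar>y\<bar> \<ge> Y \<Longrightarrow> cmod (g y) \<le> C / y\<^sup>2"
  shows "integrable lborel g"
proof -
  define Z where "Z = max \<bar>Y\<bar> 1"
  have "compact (g ` {-Z..Z})"
    by (intro compact_continuous_image continuous_on_subset[OF cont]) auto
  then obtain M where M: "\<And>y. y \<in> {-Z..Z} \<Longrightarrow> cmod (g y) \<le> M"
    using compact_imp_bounded[of "g ` {-Z..Z}"] unfolding bounded_iff by blast
  have "M \<ge> 0"
    using M[of 0] norm_ge_zero[of "g 0"] by (auto simp: Z_def intro: order_trans[of 0 "cmod (g 0)" M])
  define D where "D = max (M * (1 + Z\<^sup>2)) (2 * \<bar>C\<bar>)"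
  have bound: "cmod (g y) \<le> D * inverse (1 + y\<^sup>2)" for y
  proof -
    have pos: "1 + y\<^sup>2 > 0" by (simp add: add_pos_nonneg)
    have "cmod (g y) * (1 + y\<^sup>2) \<le> D"
    proof (cases "\<bar>y\<bar> \<le> Z")
      case True
      then have "y\<^sup>2 \<le> Z\<^sup>2" using power_mono[of "\<bar>y\<bar>" Z 2] by simp
      then have "cmod (g y) * (1 + y\<^sup>2) \<le> M * (1 + Z\<^sup>2)"
        using True \<open>M \<ge> 0\<close> by (intro mult_mono M) auto
      then show ?thesis by (simp add: D_def)
    next
      case False
      then have y: "\<bar>y\<bar> \<ge> Y" "\<bar>y\<bar> \<ge> 1" by (auto simp: Z_def)
      then have y2: "y\<^sup>2 \<ge> 1" using power_mono[of 1 "\<bar>y\<bar>" 2] by simp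
      have "cmod (g y) * (1 + y\<^sup>2) \<le> (C / y\<^sup>2) * (1 + y\<^sup>2)"
        using decay[OF y(1)] pos by (intro mult_right_mono) auto
      also have "\<dots> \<le> (\<bar>C\<bar> / y\<^sup>2) * (2 * y\<^sup>2)"
        using y2 by (intro mult_mono divide_right_mono) auto
      also have "\<dots> = 2 * \<bar>C\<bar>" using y2 by auto
      finally show ?thesis by (simp add: D_def)
    qed
    then show ?thesis using pos by (simp add: field_simps)
  qed
  have "integrable lborel (\<lambda>y::real. inverse (1 + y\<^sup>2))"
    using integrable_inverse_1_plus_square by (simp add: set_integrable_def)
  then have "integrable lborel (\<lambda>y::real. D * inverse (1 + y\<^sup>2))"
    by simp
  moreover have "g \<in> borel_measurable lborel"
    using borel_measurable_continuous_onI[OF cont] by simp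
  ultimately show ?thesis
    by (rule Bochner_Integration.integrable_bound)
      (auto intro!: AE_I2 order_trans[OF bound])
qed

lemma continuous_vertical_line:
  assumes "F holomorphic_on vertical_strip b c" "b < x" "x < c"
  shows "continuous_on UNIV (\<lambda>y. F (Complex x y))"
proof -
  have "continuous_on (vertical_strip b c) F"
    using assms(1) by (rule holomorphic_on_imp_continuous_on)
  then show ?thesis
    by (rule continuous_on_compose2)
      (use assms in \<open>auto simp: vertical_strip_def Complex_eq intro!: continuous_intros\<close>)
qed

lemma convex_vertical_strip: "convex (vertical_strip b c)"
  and open_vertical_strip: "open (vertical_strip b c)"
proof -
  have eq: "vertical_strip b c = {z. Re z > b} \<inter> {z. Re z < c}"
    by (auto simp: vertical_strip_def)
  show "convex (vertical_strip b c)" "open (vertical_strip b c)"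
    unfolding eq
    by (intro convex_Int convex_halfspace_Re_gt convex_halfspace_Re_lt
        open_Int open_halfspace_Re_gt open_halfspace_Re_lt)+
qed

definition rapid_decay_in_strip :: "(complex \<Rightarrow> complex) \<Rightarrow> real \<Rightarrow> real \<Rightarrow> bool" where
  "rapid_decay_in_strip F b c \<longleftrightarrow> F holomorphic_on vertical_strip b c \<and>
     (\<exists>C Y. \<forall>z\<in>vertical_strip b c. \<bar>Im z\<bar> \<ge> Y \<longrightarrow> cmod (F z) \<le> C / (Im z)\<^sup>2)"

lemma rapid_decay_integrable:
  assumes "rapid_decay_in_strip F b c" "b < x" "x < c"
  shows "integrable lborel (\<lambda>y. F (Complex x y))"
proof -
  obtain C Y where CY: "\<And>z. z \<in> vertical_strip b c \<Longrightarrow> \<bar>Im z\<bar> \<ge> Y \<Longrightarrow> cmod (F z) \<le> C / (Im z)\<^sup>2"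
    and F: "F holomorphic_on vertical_strip b c"
    using assms(1) by (auto simp: rapid_decay_in_strip_def)
  show ?thesis
    using CY[of "Complex x _"] assms(2,3)
    by (intro integrable_vertical_line_decay[of _ Y C] continuous_vertical_line[OF F])
      (auto simp: vertical_strip_def)
qed

lemma symmetric_integrals_tendsto:
  fixes f :: "real \<Rightarrow> complex"
  assumes f: "integrable lborel f"
  shows "(\<lambda>n. integral {- real n..real n} f) \<longlonglongrightarrow> (LINT y|lborel. f y)"
proof -
  have U: "(\<Union>n. {- real n..real n}) = UNIV"
  proof safe
    fix x :: real
    obtain n where "\<bar>x\<bar> \<le> real n" using real_arch_simple by blast
    then show "x \<in> (\<Union>n. {- real n..real n})" by (auto intro!: exI[of _ n])
  qed auto
  have "set_integrable lborel UNIV f" using f by (simp add: set_integrable_def)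
  then have sub: "set_integrable lborel {- real n..real n} f" for n
    by (rule set_integrable_subset) auto
  have "(\<lambda>n. LINT y:{- real n..real n}|lborel. f y) \<longlonglongrightarrow> (LINT y:(\<Union>n. {- real n..real n})|lborel. f y)"
    by (rule set_integral_cont_up) (use f in \<open>auto simp: U set_integrable_def incseq_def\<close>)
  then show ?thesis
    using sub by (simp add: U set_borel_integral_eq_integral(2) set_lebesgue_integral_def[of _ UNIV])
qed

text \<open>Cauchy's formula for the rectangle with vertical sides on \<open>Re z = x0\<close> and \<open>Re z = x1\<close>, which winds once
  around \<open>\<kappa>\<close>.\<close>

lemma rectangle_Cauchy_formula:
  assumes G: "G holomorphic_on vertical_strip b c"
    and x: "b < x0" "x0 < Re \<kappa>" "Re \<kappa> < x1" "x1 < c" and Y: "\<bar>Im \<kappa>\<bar> < Y"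
  defines "f \<equiv> \<lambda>z. G z / (z - \<kappa>)"
  shows "\<i> * integral {-Y..Y} (\<lambda>y. f (Complex x1 y)) - \<i> * integral {-Y..Y} (\<lambda>y. f (Complex x0 y))
     = 2 * pi * \<i> * G \<kappa> - contour_integral (linepath (Complex x0 (-Y)) (Complex x1 (-Y))) f
        - contour_integral (linepath (Complex x1 Y) (Complex x0 Y)) f"
proof -
  define \<gamma> where "\<gamma> = rectpath (Complex x0 (-Y)) (Complex x1 Y)"
  have lt: "x0 < x1" "-Y < Y" using x Y by auto
  have img: "path_image \<gamma> \<subseteq> vertical_strip b c - {\<kappa>}"
    unfolding \<gamma>_def using x Y lt
    by (subst path_image_rectpath) (auto simp: vertical_strip_def)
  have "(f has_contour_integral (2 * pi * \<i> * winding_number \<gamma> \<kappa> * G \<kappa>)) \<gamma>"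
    unfolding f_def
    by (rule Cauchy_integral_formula_convex_simple[OF convex_vertical_strip G])
      (use img x interior_open[OF open_vertical_strip, of b c] in
        \<open>auto simp: \<gamma>_def intro: vertical_strip_def[THEN equalityD2, THEN subsetD]\<close>)
  moreover have "winding_number \<gamma> \<kappa> = 1"
    unfolding \<gamma>_def by (rule winding_number_rectpath) (use x Y in \<open>auto simp: in_box_complex_iff\<close>)
  ultimately have I: "(f has_contour_integral 2 * pi * \<i> * G \<kappa>) \<gamma>" by simp
  have f_cont: "continuous_on (vertical_strip b c - {\<kappa>}) f"
    unfolding f_def using holomorphic_on_imp_continuous_on[OF G]
    by (intro continuous_intros) (auto intro: continuous_on_subset)
  define l1 l2 l3 l4 where "l1 = linepath (Complex x0 (-Y)) (Complex x1 (-Y))"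
    and "l2 = linepath (Complex x1 (-Y)) (Complex x1 Y)"
    and "l3 = linepath (Complex x1 Y) (Complex x0 Y)"
    and "l4 = linepath (Complex x0 Y) (Complex x0 (-Y))"
  have \<gamma>: "\<gamma> = l1 +++ l2 +++ l3 +++ l4"
    by (simp add: \<gamma>_def rectpath_def l1_def l2_def l3_def l4_def Let_def)
  have img': "path_image l1 \<subseteq> path_image \<gamma>" "path_image l2 \<subseteq> path_image \<gamma>"
    "path_image l3 \<subseteq> path_image \<gamma>" "path_image l4 \<subseteq> path_image \<gamma>"
    by (auto simp: \<gamma> path_image_join l1_def l2_def l3_def l4_def)
  have int: "f contour_integrable_on l1" "f contour_integrable_on l2"
    "f contour_integrable_on l3" "f contour_integrable_on l4"
    using img img' unfolding l1_def l2_def l3_def l4_def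
    by (auto intro!: contour_integrable_continuous_linepath continuous_on_subset[OF f_cont])
  have "contour_integral \<gamma> f = contour_integral l1 f + (contour_integral l2 f +
      (contour_integral l3 f + contour_integral l4 f))"
    unfolding \<gamma> using int
    by (subst contour_integral_join; simp add: l1_def l2_def l3_def l4_def)+
  moreover have "contour_integral l2 f = \<i> * integral {-Y..Y} (\<lambda>y. f (Complex x1 y))"
    unfolding l2_def using lt by (intro contour_integral_linepath_same_Re) auto
  moreover have "contour_integral l4 f = - (\<i> * integral {-Y..Y} (\<lambda>y. f (Complex x0 y)))"
    unfolding l4_def using lt
    by (subst contour_integral_reverse_linepath)
      (use img img'(4) in \<open>auto simp: l4_def intro!: continuous_on_subset[OF f_cont] contour_integral_linepath_same_Re\<close>)
  ultimately show ?thesis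
    using contour_integral_unique[OF I] by (simp add: l1_def l3_def algebra_simps)
qed

text \<open>At height at least \<open>\<bar>Im \<kappa>\<bar> + 1\<close> the denominator has modulus at least \<open>1\<close>.\<close>

lemma cauchy_quotient_decay:
  assumes "rapid_decay_in_strip G b c"
  shows "\<exists>C\<ge>0. \<exists>Y\<ge>1. \<forall>z\<in>vertical_strip b c. \<bar>Im z\<bar> \<ge> Y \<longrightarrow> cmod (G z / (z - \<kappa>)) \<le> C / (Im z)\<^sup>2"
proof -
  obtain C Y where CY: "\<And>z. z \<in> vertical_strip b c \<Longrightarrow> \<bar>Im z\<bar> \<ge> Y \<Longrightarrow> cmod (G z) \<le> C / (Im z)\<^sup>2"
    using assms by (auto simp: rapid_decay_in_strip_def)
  have "cmod (G z / (z - \<kappa>)) \<le> \<bar>C\<bar> / (Im z)\<^sup>2"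
    if z: "z \<in> vertical_strip b c" "\<bar>Im z\<bar> \<ge> max \<bar>Y\<bar> (\<bar>Im \<kappa>\<bar> + 1)" for z
  proof -
    have "1 \<le> \<bar>Im (z - \<kappa>)\<bar>"
      using z(2) abs_triangle_ineq[of "Im z - Im \<kappa>" "Im \<kappa>"] by simp
    then have "1 \<le> cmod (z - \<kappa>)" using abs_Im_le_cmod[of "z - \<kappa>"] by linarith
    then have "cmod (G z / (z - \<kappa>)) \<le> cmod (G z) / 1"
      unfolding norm_divide by (intro divide_left_mono) auto
    also have "\<dots> \<le> C / (Im z)\<^sup>2" using CY[OF z(1)] z(2) by auto
    also have "\<dots> \<le> \<bar>C\<bar> / (Im z)\<^sup>2" by (intro divide_right_mono) auto
    finally show ?thesis .
  qed
  then show ?thesis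
    by (intro exI[of _ "\<bar>C\<bar>"] conjI exI[of _ "max \<bar>Y\<bar> (\<bar>Im \<kappa>\<bar> + 1)"]) auto
qed

text \<open>Let the height of the rectangle tend to infinity. The horizontal sides have fixed length and the integrand
  on them is \<open>O(1 / n\<^sup>2)\<close> at height \<open>n\<close>.\<close>

lemma vertical_line_shift:
  assumes G: "rapid_decay_in_strip G b c"
    and x: "b < x0" "x0 < Re \<kappa>" "Re \<kappa> < x1" "x1 < c"
  defines "f \<equiv> \<lambda>z. G z / (z - \<kappa>)"
  shows "vertical_line_integral x1 f - vertical_line_integral x0 f = 2 * pi * \<i> * G \<kappa>"
proof -
  obtain C Y where C: "C \<ge> 0" "Y \<ge> 1"
    and CY: "\<And>z. z \<in> vertical_strip b c \<Longrightarrow> \<bar>Im z\<bar> \<ge> Y \<Longrightarrow> cmod (f z) \<le> C / (Im z)\<^sup>2"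
    using cauchy_quotient_decay[OF G] unfolding f_def by metis
  have hol: "G holomorphic_on vertical_strip b c"
    using G by (simp add: rapid_decay_in_strip_def)
  have cont: "continuous_on (vertical_strip b c - {\<kappa>}) f"
    unfolding f_def using holomorphic_on_imp_continuous_on[OF hol]
    by (intro continuous_intros) (auto intro: continuous_on_subset)
  have int: "integrable lborel (\<lambda>y. f (Complex x' y))" if "b < x'" "x' < c" "x' \<noteq> Re \<kappa>" for x'
    using CY[of "Complex x' _"] that
    by (intro integrable_vertical_line_decay[of _ Y C] continuous_on_compose2[OF cont])
      (auto simp: vertical_strip_def Complex_eq intro!: continuous_intros)
  define h where "h n = contour_integral (linepath (Complex x0 (- real n)) (Complex x1 (- real n))) f
     + contour_integral (linepath (Complex x1 (real n)) (Complex x0 (real n))) f" for n :: nat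
  have h_bound: "cmod (h n) \<le> 2 * C * (x1 - x0) * (1 / (real n)\<^sup>2)"
    if n: "real n > max Y \<bar>Im \<kappa>\<bar>" for n
  proof -
    have seg: "cmod (contour_integral (linepath (Complex a v) (Complex a' v)) f)
         \<le> C / (real n)\<^sup>2 * (x1 - x0)"
      if a: "{a, a'} = {x0, x1}" and v: "\<bar>v\<bar> = real n" for a a' v
    proof -
      have aa: "a \<in> {x0..x1}" "a' \<in> {x0..x1}" "\<bar>a' - a\<bar> = x1 - x0"
        using a x by (auto simp: doubleton_eq_iff)
      have z: "z \<in> vertical_strip b c - {\<kappa>}" "Im z = v"
        if "z \<in> closed_segment (Complex a v) (Complex a' v)" for z
      proof -
        have "Im z = v" "Re z \<in> closed_segment a a'"
          using that by (auto simp: closed_segment_same_Im)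
        moreover have "closed_segment a a' \<subseteq> {x0..x1}"
          using aa by (intro closed_segment_subset) auto
        ultimately show "z \<in> vertical_strip b c - {\<kappa>}" "Im z = v"
          using x v n by (auto simp: vertical_strip_def)
      qed
      have "cmod (contour_integral (linepath (Complex a v) (Complex a' v)) f)
         \<le> C / (real n)\<^sup>2 * cmod (Complex a' v - Complex a v)"
      proof (rule contour_integral_bound_linepath)
        show "f contour_integrable_on linepath (Complex a v) (Complex a' v)"
          using z by (intro contour_integrable_continuous_linepath continuous_on_subset[OF cont]) auto
        show "cmod (f w) \<le> C / (real n)\<^sup>2" if "w \<in> closed_segment (Complex a v) (Complex a' v)" for w
        proof -
          have "(real n)\<^sup>2 = v\<^sup>2" using v by (metis power2_abs)
          then show ?thesis using CY[of w] z[OF that] v n by auto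
        qed
      qed (use C in auto)
      also have "Complex a' v - Complex a v = of_real (a' - a)"
        by (simp add: complex_eq_iff)
      finally show ?thesis using aa(3) by (simp only: norm_of_real)
    qed
    have "cmod (h n) \<le> C / (real n)\<^sup>2 * (x1 - x0) + C / (real n)\<^sup>2 * (x1 - x0)"
      unfolding h_def by (intro order_trans[OF norm_triangle_ineq] add_mono seg) auto
    then show ?thesis by simp
  qed
  have "h \<longlonglongrightarrow> 0"
  proof (rule Lim_null_comparison)
    show "(\<lambda>n. 2 * C * (x1 - x0) * (1 / (real n)\<^sup>2)) \<longlonglongrightarrow> 0"
      by (rule tendsto_mult_right_zero)
        (intro lim_inverse_n'[THEN tendsto_null_power[of _ _ 2], simplified power_one_over] | simp)+
    have "eventually (\<lambda>n. real n > max Y \<bar>Im \<kappa>\<bar>) sequentially"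
      using filterlim_real_sequentially unfolding filterlim_at_top_dense by blast
    then show "\<forall>\<^sub>F n in sequentially. norm (h n) \<le> 2 * C * (x1 - x0) * (1 / (real n)\<^sup>2)"
      by eventually_elim (rule h_bound)
  qed
  then have "(\<lambda>n. 2 * pi * \<i> * G \<kappa> - h n) \<longlonglongrightarrow> 2 * pi * \<i> * G \<kappa> - 0"
    by (intro tendsto_intros)
  moreover have "eventually (\<lambda>n. 2 * pi * \<i> * G \<kappa> - h n =
     \<i> * integral {- real n..real n} (\<lambda>y. f (Complex x1 y))
      - \<i> * integral {- real n..real n} (\<lambda>y. f (Complex x0 y))) sequentially"
  proof -
    have "eventually (\<lambda>n. real n > \<bar>Im \<kappa>\<bar>) sequentially"
      using filterlim_real_sequentially by (simp add: filterlim_at_top_dense)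
    then show ?thesis
      by eventually_elim
        (use rectangle_Cauchy_formula[OF hol x] in \<open>simp add: h_def f_def\<close>)
  qed
  ultimately have "(\<lambda>n. \<i> * integral {- real n..real n} (\<lambda>y. f (Complex x1 y))
      - \<i> * integral {- real n..real n} (\<lambda>y. f (Complex x0 y))) \<longlonglongrightarrow> 2 * pi * \<i> * G \<kappa> - 0"
    by (rule Lim_transform_eventually)
  moreover have "(\<lambda>n. \<i> * integral {- real n..real n} (\<lambda>y. f (Complex x1 y))
      - \<i> * integral {- real n..real n} (\<lambda>y. f (Complex x0 y)))
     \<longlonglongrightarrow> \<i> * (LINT y|lborel. f (Complex x1 y)) - \<i> * (LINT y|lborel. f (Complex x0 y))"
    using x by (intro tendsto_intros symmetric_integrals_tendsto int) auto
  ultimately show ?thesis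
    unfolding vertical_line_integral_def using LIMSEQ_unique by (fastforce simp: mult.commute)
qed

text \<open>Passes from the modulus to the imaginary part of \<open>z\<close> in the bound, since \<open>\<bar>Im z\<bar> \<le> cmod z\<close>.\<close>

lemma rapid_decay_if_bigo:
  assumes F: "F holomorphic_on vertical_strip b c"
    and O: "F \<in> O[strip_ends b c](\<lambda>z. of_real (1 / (cmod z)\<^sup>2))"
  shows "rapid_decay_in_strip F b c"
proof -
  obtain C where C: "C > 0" "\<forall>\<^sub>F z in strip_ends b c. cmod (F z) \<le> C * cmod (of_real (1 / (cmod z)\<^sup>2))"
    using O by (rule landau_o.bigE)
  then have "\<forall>\<^sub>F z in filtercomap (\<lambda>z. \<bar>Im z\<bar>) at_top. z \<in> vertical_strip b c \<longrightarrow> cmod (F z) \<le> C / (cmod z)\<^sup>2"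
    unfolding strip_ends_def eventually_inf_principal by (simp add: norm_divide norm_power)
  then obtain Y where Y: "\<And>z. \<bar>Im z\<bar> \<ge> Y \<Longrightarrow> z \<in> vertical_strip b c \<Longrightarrow> cmod (F z) \<le> C / (cmod z)\<^sup>2"
    unfolding eventually_filtercomap_at_top_linorder by blast
  have "cmod (F z) \<le> C / (Im z)\<^sup>2"
    if z: "z \<in> vertical_strip b c" "\<bar>Im z\<bar> \<ge> max Y 1" for z
  proof -
    have "(Im z)\<^sup>2 \<le> (cmod z)\<^sup>2"
      using power_mono[OF abs_Im_le_cmod[of z], of 2] by simp
    moreover have "(Im z)\<^sup>2 > 0" using z(2) by auto
    ultimately have "C / (cmod z)\<^sup>2 \<le> C / (Im z)\<^sup>2"
      using C(1) by (intro divide_left_mono mult_pos_pos) auto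
    then show ?thesis using Y[of z] z by auto
  qed
  then show ?thesis
    unfolding rapid_decay_in_strip_def using F by blast
qed

lemma rapid_decay_mult_bounded:
  assumes F: "rapid_decay_in_strip F b c" and g: "g holomorphic_on vertical_strip b c"
    and M: "\<And>z. z \<in> vertical_strip b c \<Longrightarrow> cmod (g z) \<le> M"
  shows "rapid_decay_in_strip (\<lambda>z. F z * g z) b c"
proof -
  obtain C Y where CY: "\<And>z. z \<in> vertical_strip b c \<Longrightarrow> \<bar>Im z\<bar> \<ge> Y \<Longrightarrow> cmod (F z) \<le> C / (Im z)\<^sup>2"
    using F by (auto simp: rapid_decay_in_strip_def)
  have "cmod (F z * g z) \<le> C * M / (Im z)\<^sup>2"
    if z: "z \<in> vertical_strip b c" "\<bar>Im z\<bar> \<ge> Y" for z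
  proof -
    have "cmod (F z * g z) \<le> C / (Im z)\<^sup>2 * M"
      unfolding norm_mult
      by (intro mult_mono CY[OF z] M[OF z(1)]) (auto intro: order_trans[OF norm_ge_zero CY[OF z]])
    then show ?thesis by simp
  qed
  then show ?thesis
    using F g by (auto simp: rapid_decay_in_strip_def intro!: holomorphic_on_mult)
qed

text \<open>The left side of the line estimate in the kernel condition.\<close>

definition absolute_line_integral :: "real \<Rightarrow> (complex \<Rightarrow> complex) \<Rightarrow> real" where
  "absolute_line_integral x F = (LINT y|lborel. cmod (F (Complex x y)) / cmod (Complex x y))"

lemma vertical_line_integral_cmult:
  "vertical_line_integral x (\<lambda>z. c * f z) = c * vertical_line_integral x f"
  unfolding vertical_line_integral_def by (simp only: mult.assoc integral_mult_right_zero)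

lemma vertical_line_integral_cong:
  assumes "\<And>z. Re z = x \<Longrightarrow> f z = g z"
  shows "vertical_line_integral x f = vertical_line_integral x g"
  unfolding vertical_line_integral_def using assms by simp

lemma absolute_line_integrable:
  assumes F: "rapid_decay_in_strip F 0 c" and x: "0 < x" "x < c"
  shows "integrable lborel (\<lambda>y. cmod (F (Complex x y)) / cmod (Complex x y))"
proof (rule Bochner_Integration.integrable_bound)
  show int: "integrable lborel (\<lambda>y. F (Complex x y) / of_real x)"
    using rapid_decay_integrable[OF F x] by simp
  have "F holomorphic_on vertical_strip 0 c" using F by (simp add: rapid_decay_in_strip_def)
  then have "continuous_on UNIV (\<lambda>y. F (Complex x y))" by (rule continuous_vertical_line) fact+
  moreover have "Complex x y \<noteq> 0" for y using x by (simp add: complex_eq_iff)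
  ultimately have "continuous_on UNIV (\<lambda>y. cmod (F (Complex x y)) / cmod (Complex x y))"
    unfolding Complex_eq by (intro continuous_intros) auto
  then show "(\<lambda>y. cmod (F (Complex x y)) / cmod (Complex x y)) \<in> borel_measurable lborel"
    using borel_measurable_continuous_onI by simp
  have "cmod (F (Complex x y)) / cmod (Complex x y) \<le> cmod (F (Complex x y)) / x" for y
    using complex_Re_le_cmod[of "Complex x y"] x by (intro divide_left_mono mult_pos_pos) auto
  then show "AE y in lborel. norm (cmod (F (Complex x y)) / cmod (Complex x y)) \<le> norm (F (Complex x y) / of_real x)"
    using x by (intro AE_I2) (simp add: norm_divide)
qed

text \<open>The form in which the line estimate of the kernel condition is used: any factor that is \<open>O(1 / \<bar>z\<bar>)\<close> on the
  line may stand next to \<open>F\<close>.\<close>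

lemma vertical_line_integral_bound:
  assumes F: "rapid_decay_in_strip F 0 c" and x: "0 < x" "x < c"
    and m: "C \<ge> 0" "\<And>z. Re z = x \<Longrightarrow> cmod (m z) \<le> C / cmod z"
  shows "cmod (vertical_line_integral x (\<lambda>z. F z * m z)) \<le> C * absolute_line_integral x F"
proof (cases "integrable lborel (\<lambda>y. F (Complex x y) * m (Complex x y) * \<i>)")
  case True
  have "cmod (vertical_line_integral x (\<lambda>z. F z * m z))
      \<le> (LINT y|lborel. cmod (F (Complex x y) * m (Complex x y) * \<i>))"
    unfolding vertical_line_integral_def by (rule integral_norm_bound)
  also have "\<dots> \<le> (LINT y|lborel. C * (cmod (F (Complex x y)) / cmod (Complex x y)))"
  proof (rule integral_mono)
    show "integrable lborel (\<lambda>y. C * (cmod (F (Complex x y)) / cmod (Complex x y)))"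
      using absolute_line_integrable[OF F x] by (rule integrable_mult_right)
    show "cmod (F (Complex x y) * m (Complex x y) * \<i>) \<le> C * (cmod (F (Complex x y)) / cmod (Complex x y))" for y
      using mult_left_mono[OF m(2)[of "Complex x y"], of "cmod (F (Complex x y))"]
      by (simp add: norm_mult mult_ac)
  qed (use True in \<open>rule integrable_norm\<close>)
  also have "\<dots> = C * absolute_line_integral x F"
    unfolding absolute_line_integral_def by (rule integral_mult_right_zero)
  finally show ?thesis .
next
  case False
  \<comment> \<open>the Bochner integral of a function that is not integrable is \<open>0\<close> by definition\<close>
  then have "vertical_line_integral x (\<lambda>z. F z * m z) = 0"
    unfolding vertical_line_integral_def by (rule not_integrable_integral_eq)
  moreover have "absolute_line_integral x F \<ge> 0"
    unfolding absolute_line_integral_def by (intro integral_nonneg_AE) auto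
  ultimately show ?thesis using m(1) by simp
qed

text \<open>On the line \<open>\<bar>\<kappa> - z\<bar>\<close> is bounded below by its horizontal distance \<open>\<delta>\<close> to \<open>\<kappa>\<close>, hence
  \<open>\<bar>z\<bar> \<le> \<bar>\<kappa> - z\<bar> + \<bar>\<kappa>\<bar> \<le> (1 + \<bar>\<kappa>\<bar> / \<delta>) * \<bar>\<kappa> - z\<bar>\<close>.\<close>

lemma inverse_distance_bound:
  assumes "x > 0" "x \<noteq> Re \<kappa>"
  shows "\<exists>C\<ge>0. \<forall>z. Re z = x \<longrightarrow> 1 / cmod (\<kappa> - z) \<le> C / cmod z"
proof -
  define \<delta> where "\<delta> = \<bar>Re \<kappa> - x\<bar>"
  have \<delta>: "\<delta> > 0" using assms by (simp add: \<delta>_def)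
  have "1 / cmod (\<kappa> - z) \<le> (1 + cmod \<kappa> / \<delta>) / cmod z" if z: "Re z = x" for z
  proof -
    have "z \<noteq> 0" using z assms(1) by auto
    have ge: "\<delta> \<le> cmod (\<kappa> - z)"
      using abs_Re_le_cmod[of "\<kappa> - z"] z by (simp add: \<delta>_def)
    have "cmod z \<le> cmod (\<kappa> - z) + cmod \<kappa>"
      using norm_triangle_ineq4[of \<kappa> "\<kappa> - z"] by simp
    also have "cmod \<kappa> = cmod \<kappa> / \<delta> * \<delta>" using \<delta> by simp
    also have "\<dots> \<le> cmod \<kappa> / \<delta> * cmod (\<kappa> - z)"
      using ge \<delta> by (intro mult_left_mono) auto
    finally have "cmod z \<le> (1 + cmod \<kappa> / \<delta>) * cmod (\<kappa> - z)"
      by (simp add: algebra_simps)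
    moreover have "cmod (\<kappa> - z) > 0" using ge \<delta> by linarith
    ultimately show ?thesis
      using \<open>z \<noteq> 0\<close> by (simp add: divide_simps mult_ac)
  qed
  moreover have "1 + cmod \<kappa> / \<delta> \<ge> 0" using \<delta> by simp
  ultimately show ?thesis by blast
qed

lemma norm_over_2_pi_le: "cmod (1 / (2 * of_real pi * \<i>) * w) \<le> cmod w"
proof -
  have "cmod (1 / (2 * of_real pi * \<i>)) \<le> 1"
    using pi_gt3 by (simp add: norm_divide norm_mult)
  then show ?thesis
    unfolding norm_mult by (rule mult_left_le_one_le[rotated 2]) auto
qed

section \<open>Weighted integrals in a real coordinate\<close>

text \<open>A real coordinate \<open>v\<close> on an interval of length \<open>h\<close> that starts at the endpoint. In the application
  \<open>v\<close> is the root \<open>\<psi> powr (1 / \<beta>)\<close> of the phase. Integrals with respect to \<open>dv\<close> are written as integrals with the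
  density \<open>v'\<close>, so that no change of variables has to be carried out.\<close>

locale phase_coordinate =
  fixes h :: real and v v' :: "real \<Rightarrow> real"
  assumes h_pos: "h > 0"
    and v_cont: "continuous_on {0..h} v" and v_0: "v 0 = 0"
    and v_pos: "\<And>s. 0 < s \<Longrightarrow> s \<le> h \<Longrightarrow> v s > 0"
    and v_deriv: "\<And>s. 0 < s \<Longrightarrow> s < h \<Longrightarrow> (v has_real_derivative v' s) (at s)"
    and v'_nonneg: "\<And>s. 0 < s \<Longrightarrow> s < h \<Longrightarrow> v' s \<ge> 0"
    and v'_cont: "continuous_on {0<..<h} v'"
begin

lemma v_nonneg: "0 \<le> s \<Longrightarrow> s \<le> h \<Longrightarrow> v s \<ge> 0"
  using v_pos[of s] v_0 by (cases "s = 0") auto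

lemma v_neq_0: "0 < s \<Longrightarrow> s < h \<Longrightarrow> v s \<noteq> 0"
  using v_pos[of s] by simp

lemma powr_continuous:
  assumes "Re \<mu> > 0"
  shows "continuous_on {0..h} (\<lambda>s. complex_of_real (v s) powr \<mu>)"
  by (rule continuous_on_powr_complex) (use assms v_nonneg in \<open>auto intro!: continuous_intros v_cont\<close>)

lemma powr_continuous_open: "continuous_on {0<..<h} (\<lambda>s. complex_of_real (v s) powr \<mu>)"
  by (intro continuous_on_powr_complex continuous_intros continuous_on_subset[OF v_cont])
    (use v_neq_0 v_nonneg in force)+

lemma norm_powr: "0 < s \<Longrightarrow> s \<le> h \<Longrightarrow> cmod (complex_of_real (v s) powr \<mu>) = v s powr Re \<mu>"
  using v_pos[of s] by (simp add: norm_powr_real_powr)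

lemma powr_has_vector_derivative:
  assumes "0 < s" "s < h"
  shows "((\<lambda>s. complex_of_real (v s) powr \<mu>) has_vector_derivative
           \<mu> * (of_real (v s) powr (\<mu> - 1) * of_real (v' s))) (at s)"
proof -
  have "((\<lambda>z. z powr \<mu>) has_field_derivative \<mu> * of_real (v s) powr (\<mu> - 1)) (at (complex_of_real (v s)))"
    using v_pos[of s] assms by (intro has_field_derivative_powr) (auto simp: complex_nonpos_Reals_iff)
  moreover have "((\<lambda>s. complex_of_real (v s)) has_vector_derivative of_real (v' s)) (at s)"
    using v_deriv[OF assms] by (rule has_vector_derivative_of_real)
  ultimately have "((\<lambda>z. z powr \<mu>) \<circ> (\<lambda>s. complex_of_real (v s)) has_vector_derivative
      of_real (v' s) * (\<mu> * of_real (v s) powr (\<mu> - 1))) (at s)"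
    by (rule field_vector_diff_chain_at[rotated])
  then show ?thesis by (simp add: o_def mult_ac)
qed

text \<open>The integrand is nonnegative and has the primitive \<open>v powr x / x\<close>, which is continuous up to \<open>s = 0\<close> although
  the integrand may be unbounded there.\<close>

lemma real_weight_integrable:
  assumes "x > 0"
  shows "set_integrable lborel {0<..<h} (\<lambda>s. v s powr (x - 1) * v' s)"
proof -
  have "((\<lambda>s. v s powr (x - 1) * v' s) has_integral (v h powr x / x - v 0 powr x / x)) {0..h}"
  proof (rule fundamental_theorem_of_calculus_interior)
    show "continuous_on {0..h} (\<lambda>s. v s powr x / x)"
      using assms v_nonneg by (intro continuous_intros continuous_on_powr' v_cont) auto
    show "((\<lambda>s. v s powr x / x) has_vector_derivative v s powr (x - 1) * v' s) (at s)"
      if "s \<in> {0<..<h}" for s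
    proof -
      have "((\<lambda>s. v s powr x / x) has_real_derivative (x * v s powr (x - 1) * v' s) / x) (at s)"
        using that DERIV_fun_powr[OF v_deriv[of s] v_pos[of s], of x]
        by (intro DERIV_cdivide) (auto simp: mult_ac)
      then show ?thesis
        using assms by (simp add: has_real_derivative_iff_has_vector_derivative)
    qed
  qed (use h_pos in auto)
  then have "(\<lambda>s. v s powr (x - 1) * v' s) integrable_on {0<..<h}"
    unfolding has_integral_Icc_iff_Ioo by (auto simp: integrable_on_def)
  then have "(\<lambda>s. v s powr (x - 1) * v' s) absolutely_integrable_on {0<..<h}"
    by (rule nonnegative_absolutely_integrable_1) (auto intro!: mult_nonneg_nonneg v'_nonneg)
  moreover have "set_borel_measurable lborel {0<..<h} (\<lambda>s. v s powr (x - 1) * v' s)"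
    unfolding set_borel_measurable_def measurable_lborel2
    by (intro borel_measurable_continuous_on_indicator continuous_intros v'_cont
        continuous_on_powr' continuous_on_subset[OF v_cont]) (use v_neq_0 v_nonneg in force)+
  ultimately show ?thesis
    by (simp add: set_integrable_def set_borel_measurable_def integrable_completion)
qed

lemma weight_integrable:
  fixes k :: "real \<Rightarrow> complex"
  assumes \<mu>: "Re \<mu> > 0" and k: "continuous_on {0..h} k"
  shows "set_integrable lborel {0<..<h} (\<lambda>s. of_real (v s) powr (\<mu> - 1) * of_real (v' s) * k s)"
proof -
  have "compact (k ` {0..h})" by (intro compact_continuous_image k) auto
  then obtain M where M: "\<And>s. s \<in> {0..h} \<Longrightarrow> cmod (k s) \<le> M"
    using compact_imp_bounded[of "k ` {0..h}"] unfolding bounded_iff by blast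
  have "set_integrable lborel {0<..<h} (\<lambda>s. M * (v s powr (Re \<mu> - 1) * v' s))"
    using real_weight_integrable[OF \<mu>] by (rule set_integrable_mult_right)
  then show ?thesis
  proof (rule set_integrable_bound)
    show "set_borel_measurable lborel {0<..<h}
        (\<lambda>s. of_real (v s) powr (\<mu> - 1) * of_real (v' s) * k s)"
      unfolding set_borel_measurable_def measurable_lborel2
      by (intro borel_measurable_continuous_on_indicator continuous_intros v'_cont
          powr_continuous_open continuous_on_subset[OF k]) auto
    have "cmod (of_real (v s) powr (\<mu> - 1) * of_real (v' s) * k s)
        \<le> norm (M * (v s powr (Re \<mu> - 1) * v' s))" if s: "s \<in> {0<..<h}" for s
    proof -
      have "cmod (of_real (v s) powr (\<mu> - 1) * of_real (v' s) * k s) =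
          v s powr (Re \<mu> - 1) * v' s * cmod (k s)"
        using s v'_nonneg[of s] by (simp add: norm_mult norm_powr)
      also have "\<dots> \<le> v s powr (Re \<mu> - 1) * v' s * M"
        using s v'_nonneg[of s] by (intro mult_left_mono M) auto
      also have "\<dots> \<le> norm (M * (v s powr (Re \<mu> - 1) * v' s))"
        by (simp add: mult_ac)
      finally show ?thesis .
    qed
    then show "AE s in lborel. s \<in> {0<..<h} \<longrightarrow>
        cmod (of_real (v s) powr (\<mu> - 1) * of_real (v' s) * k s)
        \<le> norm (M * (v s powr (Re \<mu> - 1) * v' s))"
      by (intro AE_I2) auto
  qed
qed

text \<open>The Mellin transform \<open>\<integral> v powr (\<mu> - 1) * k dv\<close>.\<close>

definition weight_integral :: "complex \<Rightarrow> (real \<Rightarrow> complex) \<Rightarrow> complex" where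
  "weight_integral \<mu> k = (LINT s:{0<..<h}|lborel. of_real (v s) powr (\<mu> - 1) * of_real (v' s) * k s)"

lemma weight_integral_by_parts:
  assumes \<mu>: "Re \<mu> > 0"
    and k: "continuous_on {0..h} k" and k': "continuous_on {0..h} k'"
    and deriv: "\<And>s. 0 < s \<Longrightarrow> s < h \<Longrightarrow> (k has_vector_derivative k' s) (at s)"
  shows "\<mu> * weight_integral \<mu> k =
    of_real (v h) powr \<mu> * k h - integral {0..h} (\<lambda>s. of_real (v s) powr \<mu> * k' s)"
proof -
  let ?w = "\<lambda>s. of_real (v s) powr (\<mu> - 1) * of_real (v' s) * k s"
  have "((\<lambda>s. \<mu> * ?w s + of_real (v s) powr \<mu> * k' s) has_integral
      (of_real (v h) powr \<mu> * k h - of_real (v 0) powr \<mu> * k 0)) {0..h}"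
  proof (rule fundamental_theorem_of_calculus_interior)
    show "continuous_on {0..h} (\<lambda>s. of_real (v s) powr \<mu> * k s)"
      by (intro continuous_intros powr_continuous \<mu> k)
    show "((\<lambda>s. of_real (v s) powr \<mu> * k s) has_vector_derivative
        \<mu> * ?w s + of_real (v s) powr \<mu> * k' s) (at s)" if "s \<in> {0<..<h}" for s
      using has_vector_derivative_mult[OF powr_has_vector_derivative[of s \<mu>] deriv[of s]] that
      by (simp add: algebra_simps)
  qed (use h_pos in auto)
  moreover have "((\<lambda>s. of_real (v s) powr \<mu> * k' s) has_integral
      integral {0..h} (\<lambda>s. of_real (v s) powr \<mu> * k' s)) {0..h}"
    by (intro integrable_integral integrable_continuous_real continuous_intros powr_continuous \<mu> k')
  ultimately have "((\<lambda>s. (\<mu> * ?w s + of_real (v s) powr \<mu> * k' s) - of_real (v s) powr \<mu> * k' s)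
      has_integral (of_real (v h) powr \<mu> * k h - of_real (v 0) powr \<mu> * k 0) -
        integral {0..h} (\<lambda>s. of_real (v s) powr \<mu> * k' s)) {0..h}"
    by (rule has_integral_diff)
  then have "((\<lambda>s. \<mu> * ?w s) has_integral of_real (v h) powr \<mu> * k h -
        integral {0..h} (\<lambda>s. of_real (v s) powr \<mu> * k' s)) {0<..<h}"
    by (simp add: v_0 has_integral_Icc_iff_Ioo)
  moreover have "((\<lambda>s. \<mu> * ?w s) has_integral \<mu> * weight_integral \<mu> k) {0<..<h}"
    unfolding weight_integral_def using set_borel_integral_eq_integral[OF weight_integrable[OF \<mu> k]]
    by (intro has_integral_mult_right) (simp add: integrable_integral)
  ultimately show ?thesis by (simp add: has_integral_unique)
qed

lemma weight_integral_1:
  assumes "Re \<mu> > 0"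
  shows "weight_integral \<mu> (\<lambda>_. 1) = of_real (v h) powr \<mu> / \<mu>"
proof -
  have "\<mu> \<noteq> 0" using assms by auto
  then show ?thesis
    using weight_integral_by_parts[OF assms, of "\<lambda>_. 1" "\<lambda>_. 0"] by (simp add: field_simps)
qed

text \<open>After an integration by parts, \<open>\<mu>\<close> times the integral is bounded by quantities that depend on \<open>\<mu>\<close> only through
  \<open>Re \<mu>\<close>. This gives the decay \<open>O(1 / \<bar>\<mu>\<bar>)\<close> along vertical lines.\<close>

lemma weight_integral_bound:
  assumes x: "x > 0" and k: "continuous_on {0..h} k" and k': "continuous_on {0..h} k'"
    and deriv: "\<And>s. 0 < s \<Longrightarrow> s < h \<Longrightarrow> (k has_vector_derivative k' s) (at s)"
  shows "\<exists>C\<ge>0. \<forall>\<mu>. Re \<mu> = x \<longrightarrow> cmod (weight_integral \<mu> k) \<le> C / cmod \<mu>"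
proof -
  define C where "C = v h powr x * cmod (k h) + integral {0..h} (\<lambda>s. v s powr x * cmod (k' s))"
  have int: "(\<lambda>s. v s powr x * cmod (k' s)) integrable_on {0..h}"
    using x v_nonneg
    by (intro integrable_continuous_real continuous_intros continuous_on_powr' v_cont k') auto
  have "C \<ge> 0"
    unfolding C_def using int by (intro add_nonneg_nonneg integral_nonneg) auto
  have "cmod (weight_integral \<mu> k) \<le> C / cmod \<mu>" if \<mu>: "Re \<mu> = x" for \<mu>
  proof -
    have "cmod (integral {0..h} (\<lambda>s. of_real (v s) powr \<mu> * k' s))
        \<le> integral {0..h} (\<lambda>s. v s powr x * cmod (k' s))"
    proof (rule integral_norm_bound_integral)
      show "cmod (of_real (v s) powr \<mu> * k' s) \<le> v s powr x * cmod (k' s)" if "s \<in> {0..h}" for s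
        using that \<mu> by (cases "s = 0") (auto simp: norm_mult norm_powr v_0)
    qed (use \<mu> x in \<open>auto intro!: int integrable_continuous_real continuous_intros powr_continuous k'\<close>)
    moreover have "cmod (of_real (v h) powr \<mu> * k h) = v h powr x * cmod (k h)"
      using \<mu> h_pos by (simp add: norm_mult norm_powr)
    ultimately have "cmod (of_real (v h) powr \<mu> * k h - integral {0..h} (\<lambda>s. of_real (v s) powr \<mu> * k' s)) \<le> C"
      unfolding C_def by (intro order_trans[OF norm_triangle_ineq4] add_mono) auto
    moreover have "Re \<mu> > 0" using \<mu> x by simp
    ultimately have "cmod (\<mu> * weight_integral \<mu> k) \<le> C"
      by (simp only: weight_integral_by_parts[OF _ k k' deriv])
    moreover have "cmod \<mu> > 0" using \<mu> x by auto
    ultimately show ?thesis by (simp add: norm_mult field_simps)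
  qed
  with \<open>C \<ge> 0\<close> show ?thesis by blast
qed

text \<open>Fubini's theorem. The modulus of the integrand is a product of a function of \<open>s\<close> and a function of \<open>y\<close>, because
  \<open>\<bar>v powr (- \<beta> * z)\<bar>\<close> depends on \<open>Re z\<close> only. The hypothesis on \<open>\<nu>\<close> is the convergence of
  the \<open>s\<close>-integral at \<open>s = 0\<close>: the line has to lie to the left of \<open>Re \<nu> / \<beta>\<close>.\<close>

lemma integral_vertical_line_swap:
  assumes F: "continuous_on UNIV (\<lambda>y. F (Complex x y))" "integrable lborel (\<lambda>y. F (Complex x y))"
    and \<nu>: "Re \<nu> - \<beta> * x > 0" and k: "continuous_on {0..h} k"
  shows "(LINT s:{0<..<h}|lborel. vertical_line_integral x (\<lambda>z. F z * of_real (v s) powr (- of_real \<beta> * z))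
            * (of_real (v s) powr (\<nu> - 1) * of_real (v' s) * k s))
       = vertical_line_integral x (\<lambda>z. F z * weight_integral (\<nu> - of_real \<beta> * z) k)"
    (is "?lhs = ?rhs")
proof -
  define I where "I = {0<..<h}"
  \<comment> \<open>extension by zero outside of the interval turns all factors into Borel functions on the line\<close>
  define L where "L s = indicator I s *\<^sub>R ln (v s)" for s
  define W where "W s = indicator I s *\<^sub>R (of_real (v s) powr (\<nu> - 1) * of_real (v' s) * k s)" for s
  define z where "z = Complex x"
  define E where "E s y = exp (- of_real \<beta> * z y * of_real (L s))" for s y
  define f where "f s y = W s * E s y * F (z y)" for s y
  have L [measurable]: "L \<in> borel_measurable borel"
    unfolding L_def I_def
    by (intro borel_measurable_continuous_on_indicator continuous_intros
        continuous_on_subset[OF v_cont]) (use v_neq_0 in auto)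
  have W [measurable]: "W \<in> borel_measurable borel"
    unfolding W_def I_def
    by (intro borel_measurable_continuous_on_indicator continuous_intros v'_cont
          powr_continuous_open continuous_on_subset[OF k]) auto
  have z [measurable]: "z \<in> borel_measurable borel"
  proof -
    have "z = (\<lambda>y. of_real x + \<i> * of_real y)"
      by (simp add: fun_eq_iff z_def Complex_eq)
    then show ?thesis
      by (simp only:) (intro borel_measurable_continuous_onI continuous_intros)
  qed
  have Fz [measurable]: "(\<lambda>y. F (z y)) \<in> borel_measurable borel"
    unfolding z_def using F(1) by (rule borel_measurable_continuous_onI)
  have E_eq: "of_real (v s) powr (- of_real \<beta> * z y) = E s y" if "s \<in> I" for s y
  proof -
    have "v s > 0" "L s = ln (v s)"
      using v_pos[of s] that by (auto simp: L_def I_def)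
    then have "complex_of_real (v s) \<noteq> 0" "Ln (of_real (v s)) = of_real (L s)"
      by (simp_all add: Ln_of_real)
    then show ?thesis
      unfolding E_def powr_def by simp
  qed
  have W_E: "W s * E s y =
      indicator I s *\<^sub>R (of_real (v s) powr ((\<nu> - of_real \<beta> * z y) - 1) * of_real (v' s) * k s)" for s y
  proof (cases "s \<in> I")
    case True
    have "(\<nu> - of_real \<beta> * z y) - 1 = (\<nu> - 1) + (- of_real \<beta> * z y)" by simp
    then have "complex_of_real (v s) powr ((\<nu> - of_real \<beta> * z y) - 1)
       = of_real (v s) powr (\<nu> - 1) * of_real (v s) powr (- of_real \<beta> * z y)"
      by (simp only: powr_add)
    then show ?thesis unfolding W_def E_eq[OF True] using True by simp
  qed (simp add: W_def)
  have Re_\<nu>: "Re (\<nu> - of_real \<beta> * z y) > 0" for y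
    using \<nu> by (simp add: z_def)
  have W_int: "integrable lborel (\<lambda>s. W s * E s y)" for y
    using weight_integrable[OF Re_\<nu> k] unfolding W_E set_integrable_def I_def .
  have norm_f: "norm (f s y) = norm (W s * E s 0) * norm (F (z y))" for s y
    by (simp add: f_def norm_mult norm_exp_eq_Re E_def z_def)
  have "integrable (lborel \<Otimes>\<^sub>M lborel) (case_prod f)"
  proof (rule lborel_pair.Fubini_integrable)
    show "case_prod f \<in> borel_measurable (lborel \<Otimes>\<^sub>M lborel)"
      unfolding f_def E_def by measurable
    show "integrable lborel (\<lambda>s. LINT y|lborel. norm (case_prod f (s, y)))"
      unfolding prod.case norm_f using integrable_norm[OF W_int[of 0]] by simp
    have "integrable lborel (f s)" for s
    proof (rule Bochner_Integration.integrable_bound)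
      show "integrable lborel (\<lambda>y. norm (W s * E s 0) * norm (F (z y)))"
        using F(2) unfolding z_def by (intro integrable_mult_right integrable_norm)
      show "f s \<in> borel_measurable lborel"
        unfolding f_def E_def by measurable
    qed (simp add: norm_f)
    then show "AE s in lborel. integrable lborel (\<lambda>y. case_prod f (s, y))"
      by simp
  qed
  from lborel_pair.Fubini_integral[OF this]
  have fub: "(LINT y|lborel. LINT s|lborel. f s y) = (LINT s|lborel. LINT y|lborel. f s y)" .
  have "F (z y) * weight_integral (\<nu> - of_real \<beta> * z y) k * \<i> = \<i> * (LINT s|lborel. f s y)" for y
  proof -
    have "(LINT s|lborel. f s y) = (LINT s|lborel. W s * E s y) * F (z y)"
      unfolding f_def by (rule integral_mult_left_zero)
    also have "(LINT s|lborel. W s * E s y) = weight_integral (\<nu> - of_real \<beta> * z y) k"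
      unfolding W_E weight_integral_def set_lebesgue_integral_def I_def ..
    finally show ?thesis by (simp only: mult_ac)
  qed
  then have rhs: "?rhs = \<i> * (LINT y|lborel. LINT s|lborel. f s y)"
    unfolding vertical_line_integral_def z_def by (simp only: integral_mult_right_zero)
  have lhs: "indicator {0<..<h} s *\<^sub>R
         (vertical_line_integral x (\<lambda>z. F z * of_real (v s) powr (- of_real \<beta> * z)) *
          (of_real (v s) powr (\<nu> - 1) * of_real (v' s) * k s)) = \<i> * (LINT y|lborel. f s y)" for s
  proof (cases "s \<in> I")
    case True
    have "F (z y) * of_real (v s) powr (- of_real \<beta> * z y) * \<i> = \<i> * (E s y * F (z y))" for y
      unfolding E_eq[OF True] by (simp only: mult_ac)
    then have vli: "vertical_line_integral x (\<lambda>z. F z * of_real (v s) powr (- of_real \<beta> * z))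
        = \<i> * (LINT y|lborel. E s y * F (z y))"
      unfolding vertical_line_integral_def z_def by (simp only: integral_mult_right_zero)
    have fi: "(LINT y|lborel. f s y) = W s * (LINT y|lborel. E s y * F (z y))"
      unfolding f_def by (simp only: mult.assoc integral_mult_right_zero)
    have ws: "of_real (v s) powr (\<nu> - 1) * of_real (v' s) * k s = W s"
      using True by (simp add: W_def)
    have ind: "indicator {0<..<h} s = (1::real)"
      using True by (simp add: I_def)
    show ?thesis
      unfolding vli fi ws ind scaleR_one by (simp only: mult_ac)
  qed (simp add: f_def W_def I_def)
  have "?lhs = (LINT s|lborel. \<i> * (LINT y|lborel. f s y))"
    unfolding set_lebesgue_integral_def by (simp only: lhs)
  also have "\<dots> = ?rhs" unfolding rhs fub by simp
  finally show ?thesis .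
qed

end

section \<open>Expansion of integrals of a Mellin transform\<close>

lemma set_integral_sum:
  fixes f :: "'i \<Rightarrow> real \<Rightarrow> complex"
  assumes "finite I" "\<And>i. i \<in> I \<Longrightarrow> set_integrable M A (f i)"
  shows "set_integrable M A (\<lambda>s. \<Sum>i\<in>I. f i s)"
    "(LINT s:A|M. (\<Sum>i\<in>I. f i s)) = (\<Sum>i\<in>I. LINT s:A|M. f i s)"
  using Bochner_Integration.integrable_sum[of I M "\<lambda>i s. indicator A s *\<^sub>R f i s"]
    Bochner_Integration.integral_sum[of I M "\<lambda>i s. indicator A s *\<^sub>R f i s"] assms(2)
  unfolding set_integrable_def set_lebesgue_integral_def scaleR_sum_right by blast+

context phase_coordinate
begin

text \<open>The representation of the exponential in the kernel condition, for one fixed value of the large parameter and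
  in terms of the coordinate \<open>v\<close> instead of \<open>\<psi> = v powr \<beta>\<close>.\<close>

definition Mellin_representation :: "real \<Rightarrow> (complex \<Rightarrow> complex) \<Rightarrow> real \<Rightarrow> (real \<Rightarrow> complex) \<Rightarrow> bool" where
  "Mellin_representation \<beta> F c E \<longleftrightarrow> rapid_decay_in_strip F 0 c \<and>
     (\<forall>x s. 0 < x \<and> x < c \<and> 0 < s \<and> s < h \<longrightarrow>
        E s = 1 / (2 * of_real pi * \<i>) *
          vertical_line_integral x (\<lambda>z. F z * of_real (v s) powr (- of_real \<beta> * z)))"

lemma integral_as_line_integral:
  assumes E: "Mellin_representation \<beta> F c E" and x: "0 < x" "x < c"
    and \<nu>: "Re \<nu> - \<beta> * x > 0" and k: "continuous_on {0..h} k"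
  shows "(LINT s:{0<..<h}|lborel. E s * (of_real (v s) powr (\<nu> - 1) * of_real (v' s) * k s))
       = 1 / (2 * of_real pi * \<i>) *
          vertical_line_integral x (\<lambda>z. F z * weight_integral (\<nu> - of_real \<beta> * z) k)"
proof -
  have F: "rapid_decay_in_strip F 0 c" using E by (simp add: Mellin_representation_def)
  let ?w = "\<lambda>s. of_real (v s) powr (\<nu> - 1) * of_real (v' s) * k s"
  let ?V = "\<lambda>s. vertical_line_integral x (\<lambda>z. F z * of_real (v s) powr (- of_real \<beta> * z))"
  have "(LINT s:{0<..<h}|lborel. E s * ?w s)
      = (LINT s:{0<..<h}|lborel. 1 / (2 * of_real pi * \<i>) * (?V s * ?w s))"
    by (rule set_lebesgue_integral_cong)
      (use E x in \<open>auto simp: Mellin_representation_def\<close>)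
  also have "\<dots> = 1 / (2 * of_real pi * \<i>) * (LINT s:{0<..<h}|lborel. ?V s * ?w s)"
    by (rule set_integral_mult_right)
  also have "(LINT s:{0<..<h}|lborel. ?V s * ?w s)
      = vertical_line_integral x (\<lambda>z. F z * weight_integral (\<nu> - of_real \<beta> * z) k)"
    using F rapid_decay_integrable[OF F x] continuous_vertical_line[of F 0 c x] x \<nu> k
    by (intro integral_vertical_line_swap) (auto simp: rapid_decay_in_strip_def)
  finally show ?thesis .
qed

text \<open>If the weight vanishes to a high order, \<open>Re z = x\<close> already lies to the left of the first pole \<open>\<kappa>\<close> of its
  Mellin transform, and the integral equals a line integral over \<open>Re z = x\<close>. The constant does not depend on \<open>F\<close>,
  which makes the bound uniform in the large parameter.\<close>

lemma remainder_integral_bound: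
  assumes \<beta>: "\<beta> > 0" and x: "0 < x" "x < Re \<kappa>"
    and k: "continuous_on {0..h} k" "continuous_on {0..h} k'"
    and deriv: "\<And>s. 0 < s \<Longrightarrow> s < h \<Longrightarrow> (k has_vector_derivative k' s) (at s)"
  shows "\<exists>C\<ge>0. \<forall>F c E. Mellin_representation \<beta> F c E \<and> x < c \<longrightarrow>
     cmod (LINT s:{0<..<h}|lborel. E s * (of_real (v s) powr (of_real \<beta> * \<kappa> - 1) * of_real (v' s) * k s))
       \<le> C * absolute_line_integral x F"
proof -
  obtain C1 where C1: "C1 \<ge> 0"
    "\<And>\<mu>. Re \<mu> = \<beta> * (Re \<kappa> - x) \<Longrightarrow> cmod (weight_integral \<mu> k) \<le> C1 / cmod \<mu>"
    using weight_integral_bound[OF _ k deriv, of "\<beta> * (Re \<kappa> - x)"] \<beta> x by auto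
  obtain C2 where C2: "C2 \<ge> 0" "\<And>z. Re z = x \<Longrightarrow> 1 / cmod (\<kappa> - z) \<le> C2 / cmod z"
    using inverse_distance_bound[of x \<kappa>] x by auto
  define C where "C = C1 / \<beta> * C2"
  have C: "C \<ge> 0" using C1 C2 \<beta> by (simp add: C_def)
  have weight: "cmod (weight_integral (of_real \<beta> * \<kappa> - of_real \<beta> * z) k) \<le> C / cmod z"
    if z: "Re z = x" for z
  proof -
    have "cmod (weight_integral (of_real \<beta> * \<kappa> - of_real \<beta> * z) k)
        \<le> C1 / cmod (of_real \<beta> * \<kappa> - of_real \<beta> * z)"
      using z by (intro C1) (simp add: algebra_simps)
    also have "cmod (of_real \<beta> * \<kappa> - of_real \<beta> * z) = \<beta> * cmod (\<kappa> - z)"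
      using \<beta> by (simp add: norm_mult flip: right_diff_distrib)
    also have "C1 / (\<beta> * cmod (\<kappa> - z)) = C1 / \<beta> * (1 / cmod (\<kappa> - z))"
      by simp
    also have "\<dots> \<le> C1 / \<beta> * (C2 / cmod z)"
      using C1 \<beta> by (intro mult_left_mono C2 z) auto
    finally show ?thesis by (simp add: C_def)
  qed
  have "cmod (LINT s:{0<..<h}|lborel. E s * (of_real (v s) powr (of_real \<beta> * \<kappa> - 1) * of_real (v' s) * k s))
       \<le> C * absolute_line_integral x F"
    if E: "Mellin_representation \<beta> F c E" "x < c" for F c E
  proof -
    have F: "rapid_decay_in_strip F 0 c" using E by (simp add: Mellin_representation_def)
    have A: "absolute_line_integral x F \<ge> 0"
      unfolding absolute_line_integral_def by (intro integral_nonneg_AE) auto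
    have "cmod (vertical_line_integral x (\<lambda>z. F z * weight_integral (of_real \<beta> * \<kappa> - of_real \<beta> * z) k))
        \<le> C * absolute_line_integral x F"
      by (rule vertical_line_integral_bound[OF F x(1) E(2) C weight])
    then show ?thesis
      using integral_as_line_integral[OF E(1) x(1) E(2) _ k(1), of "of_real \<beta> * \<kappa>"] \<beta> x
        norm_over_2_pi_le[THEN order_trans]
      by simp
  qed
  with C show ?thesis by blast
qed

text \<open>Here \<open>Re z = x\<close> lies to the right of the pole \<open>\<kappa>\<close>. The integral is first represented on a line to the left of
  \<open>\<kappa>\<close>; moving the line across the pole splits off \<open>F \<kappa> / \<beta>\<close>. Again the constant does not depend on \<open>F\<close>.\<close>

lemma power_integral_expansion:
  assumes \<beta>: "\<beta> > 0" and x: "0 < Re \<kappa>" "Re \<kappa> < x"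
  shows "\<exists>C\<ge>0. \<forall>F c E. Mellin_representation \<beta> F c E \<and> x < c \<longrightarrow>
     cmod ((LINT s:{0<..<h}|lborel. E s * (of_real (v s) powr (of_real \<beta> * \<kappa> - 1) * of_real (v' s)))
         - F \<kappa> / of_real \<beta>) \<le> C * absolute_line_integral x F"
proof -
  have vh: "v h > 0" using v_pos[of h] h_pos by simp
  define p where "p z = complex_of_real (v h) powr (of_real \<beta> * \<kappa> - of_real \<beta> * z)" for z
  have norm_p: "cmod (p z) = v h powr (\<beta> * (Re \<kappa> - Re z))" for z
    unfolding p_def using vh by (simp add: norm_powr_real_powr algebra_simps)
  obtain C2 where C2: "C2 \<ge> 0" "\<And>z. Re z = x \<Longrightarrow> 1 / cmod (\<kappa> - z) \<le> C2 / cmod z"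
    using inverse_distance_bound[of x \<kappa>] x by auto
  define C1 where "C1 = v h powr (\<beta> * (Re \<kappa> - x))"
  define C where "C = C1 / \<beta> * C2"
  have C: "C \<ge> 0" using C2 \<beta> by (simp add: C_def C1_def)
  define m where "m z = - (1 / of_real \<beta>) * (p z / (z - \<kappa>))" for z
  have m_bound: "cmod (m z) \<le> C / cmod z" if z: "Re z = x" for z
  proof -
    have "cmod (m z) = C1 / \<beta> * (1 / cmod (\<kappa> - z))"
      using \<beta> z by (simp add: m_def norm_mult norm_divide norm_p C1_def norm_minus_commute)
    also have "\<dots> \<le> C1 / \<beta> * (C2 / cmod z)"
      using \<beta> by (intro mult_left_mono C2 z) (auto simp: C1_def)
    finally show ?thesis by (simp add: C_def)
  qed
  have "cmod ((LINT s:{0<..<h}|lborel. E s * (of_real (v s) powr (of_real \<beta> * \<kappa> - 1) * of_real (v' s)))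
         - F \<kappa> / of_real \<beta>) \<le> C * absolute_line_integral x F" (is "cmod (?I - _) \<le> _")
    if E: "Mellin_representation \<beta> F c E" "x < c" for F c E
  proof -
    have F: "rapid_decay_in_strip F 0 c" using E by (simp add: Mellin_representation_def)
    \<comment> \<open>any line between \<open>0\<close> and the pole would do\<close>
    define x0 where "x0 = Re \<kappa> / 2"
    have x0: "0 < x0" "x0 < Re \<kappa>" "x0 < c" using x E(2) by (auto simp: x0_def)
    define G where "G z = F z * p z" for z
    have G: "rapid_decay_in_strip G 0 c"
      unfolding G_def
    proof (rule rapid_decay_mult_bounded[OF F])
      show "p holomorphic_on vertical_strip 0 c"
        unfolding p_def using vh by (intro holomorphic_intros) auto
      show "cmod (p z) \<le> max (v h powr (\<beta> * Re \<kappa>)) (v h powr (\<beta> * (Re \<kappa> - c)))"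
        if "z \<in> vertical_strip 0 c" for z
      proof (cases "v h \<ge> 1")
        case True
        then have "v h powr (\<beta> * (Re \<kappa> - Re z)) \<le> v h powr (\<beta> * Re \<kappa>)"
          using that \<beta> by (intro powr_mono) (auto simp: vertical_strip_def)
        then show ?thesis by (simp add: norm_p)
      next
        case False
        then have "v h powr (\<beta> * (Re \<kappa> - Re z)) \<le> v h powr (\<beta> * (Re \<kappa> - c))"
          using that \<beta> vh by (intro powr_mono') (auto simp: vertical_strip_def)
        then show ?thesis by (simp add: norm_p)
      qed
    qed
    have m_eq: "F z * m z = - (1 / of_real \<beta>) * (G z / (z - \<kappa>))" for z
      by (simp add: m_def G_def)
    have "?I = 1 / (2 * of_real pi * \<i>) *
        vertical_line_integral x0 (\<lambda>z. F z * weight_integral (of_real \<beta> * \<kappa> - of_real \<beta> * z) (\<lambda>_. 1))"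
      using integral_as_line_integral[OF E(1) x0(1,3), of "of_real \<beta> * \<kappa>" "\<lambda>_. 1"] \<beta> x0 by simp
    also have "vertical_line_integral x0 (\<lambda>z. F z * weight_integral (of_real \<beta> * \<kappa> - of_real \<beta> * z) (\<lambda>_. 1))
        = vertical_line_integral x0 (\<lambda>z. - (1 / of_real \<beta>) * (G z / (z - \<kappa>)))"
    proof (rule vertical_line_integral_cong)
      fix z assume z: "Re z = x0"
      then have "z \<noteq> \<kappa>" using x0 by auto
      then have "of_real \<beta> * \<kappa> - of_real \<beta> * z \<noteq> 0" using \<beta> by auto
      then show "F z * weight_integral (of_real \<beta> * \<kappa> - of_real \<beta> * z) (\<lambda>_. 1)
          = - (1 / of_real \<beta>) * (G z / (z - \<kappa>))"
        using z x0 \<beta> \<open>z \<noteq> \<kappa>\<close>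
        by (simp add: weight_integral_1 G_def p_def field_simps)
    qed
    also have "\<dots> = - (1 / of_real \<beta>) * vertical_line_integral x0 (\<lambda>z. G z / (z - \<kappa>))"
      by (rule vertical_line_integral_cmult)
    also have "vertical_line_integral x0 (\<lambda>z. G z / (z - \<kappa>)) =
        vertical_line_integral x (\<lambda>z. G z / (z - \<kappa>)) - 2 * pi * \<i> * F \<kappa>"
      using vertical_line_shift[OF G x0(1,2) x(2) E(2)] vh by (simp add: G_def p_def algebra_simps)
    also have "1 / (2 * of_real pi * \<i>) * (- (1 / of_real \<beta>) *
          (vertical_line_integral x (\<lambda>z. G z / (z - \<kappa>)) - 2 * pi * \<i> * F \<kappa>))
        = F \<kappa> / of_real \<beta> + 1 / (2 * of_real pi * \<i>) *
            (- (1 / of_real \<beta>) * vertical_line_integral x (\<lambda>z. G z / (z - \<kappa>)))"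
      using \<beta> by (simp add: field_simps)
    also have "- (1 / of_real \<beta>) * vertical_line_integral x (\<lambda>z. G z / (z - \<kappa>))
        = vertical_line_integral x (\<lambda>z. F z * m z)"
      unfolding m_eq by (rule vertical_line_integral_cmult[symmetric])
    finally have "?I - F \<kappa> / of_real \<beta> = 1 / (2 * of_real pi * \<i>) * vertical_line_integral x (\<lambda>z. F z * m z)"
      by simp
    also have "cmod \<dots> \<le> cmod (vertical_line_integral x (\<lambda>z. F z * m z))"
      by (rule norm_over_2_pi_le)
    also have "\<dots> \<le> C * absolute_line_integral x F"
      using x by (intro vertical_line_integral_bound[OF F _ E(2) C m_bound]) auto
    finally show ?thesis .
  qed
  with C show ?thesis by blast
qed

lemma bounded_weight_integrable:
  fixes E k :: "real \<Rightarrow> complex"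
  assumes E: "continuous_on {0<..<h} E" "\<And>s. 0 < s \<Longrightarrow> s < h \<Longrightarrow> cmod (E s) \<le> 1"
    and \<mu>: "Re \<mu> > 0" and k: "continuous_on {0..h} k"
  shows "set_integrable lborel {0<..<h} (\<lambda>s. E s * (of_real (v s) powr (\<mu> - 1) * of_real (v' s) * k s))"
  using weight_integrable[OF \<mu> k]
proof (rule set_integrable_bound)
  show "set_borel_measurable lborel {0<..<h} (\<lambda>s. E s * (of_real (v s) powr (\<mu> - 1) * of_real (v' s) * k s))"
    unfolding set_borel_measurable_def measurable_lborel2
    by (intro borel_measurable_continuous_on_indicator continuous_intros E v'_cont
        powr_continuous_open continuous_on_subset[OF k]) auto
  show "AE s in lborel. s \<in> {0<..<h} \<longrightarrow>
      cmod (E s * (of_real (v s) powr (\<mu> - 1) * of_real (v' s) * k s))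
      \<le> cmod (of_real (v s) powr (\<mu> - 1) * of_real (v' s) * k s)"
    unfolding norm_mult[of "E _"] by (intro AE_I2 impI mult_left_le_one_le E(2)) auto
qed

text \<open>All powers and the remainder are estimated on one common line, which separates the exponents \<open>e n\<close>,
  \<open>n < N\<close>, from \<open>e N\<close>.\<close>

lemma local_integral_expansion:
  fixes e d :: "nat \<Rightarrow> complex"
  assumes \<beta>: "\<beta> > 0" and \<alpha>: "Re \<alpha> > -1" and e: "\<And>n. of_real \<beta> * e n = \<alpha> + 1 + of_nat n"
    and x: "0 < x" "\<And>n. n < N \<Longrightarrow> Re (e n) < x" "x < Re (e N)"
    and k: "continuous_on {0..h} k" "continuous_on {0..h} k'"
    and deriv: "\<And>s. 0 < s \<Longrightarrow> s < h \<Longrightarrow> (k has_vector_derivative k' s) (at s)"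
  shows "\<exists>C\<ge>0. \<forall>F c E. Mellin_representation \<beta> F c E \<and> x < c \<and>
       continuous_on {0<..<h} E \<and> (\<forall>s. 0 < s \<and> s < h \<longrightarrow> cmod (E s) \<le> 1) \<longrightarrow>
     cmod ((LINT s:{0<..<h}|lborel. E s * (of_real (v s) powr \<alpha> * of_real (v' s) *
            ((\<Sum>n<N. of_real \<beta> * d n * of_real (v s) ^ n) + of_real (v s) ^ N * k s)))
         - (\<Sum>n<N. F (e n) * d n)) \<le> C * absolute_line_integral x F"
proof -
  have e_pos: "Re (of_real \<beta> * e n) > 0" for n
    unfolding e using \<alpha> by simp
  then have Re_e: "Re (e n) > 0" for n
    using \<beta> zero_less_mult_pos[of \<beta> "Re (e n)"] by simp
  let ?I = "\<lambda>E n. LINT s:{0<..<h}|lborel. E s * (of_real (v s) powr (of_real \<beta> * e n - 1) * of_real (v' s))"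
  let ?J = "\<lambda>E. LINT s:{0<..<h}|lborel. E s * (of_real (v s) powr (of_real \<beta> * e N - 1) * of_real (v' s) * k s)"
  define P where "P n C \<longleftrightarrow> C \<ge> 0 \<and> (\<forall>F c E. Mellin_representation \<beta> F c E \<and> x < c \<longrightarrow>
     cmod (?I E n - F (e n) / of_real \<beta>) \<le> C * absolute_line_integral x F)" for n C
  have "\<exists>C. P n C" if "n \<in> {..<N}" for n
    unfolding P_def using power_integral_expansion[OF \<beta> Re_e x(2)] that by blast
  then obtain C where "\<And>n. n \<in> {..<N} \<Longrightarrow> P n (C n)"
    by metis
  then have C: "\<And>n. n < N \<Longrightarrow> C n \<ge> 0"
    "\<And>n F c E. n < N \<Longrightarrow> Mellin_representation \<beta> F c E \<Longrightarrow> x < c \<Longrightarrow>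
      cmod (?I E n - F (e n) / of_real \<beta>) \<le> C n * absolute_line_integral x F"
    unfolding P_def by blast+
  obtain C' where C': "C' \<ge> 0" "\<And>F c E. Mellin_representation \<beta> F c E \<Longrightarrow> x < c \<Longrightarrow>
      cmod (?J E) \<le> C' * absolute_line_integral x F"
    using remainder_integral_bound[OF \<beta> x(1,3) k deriv] by blast
  define D where "D = (\<Sum>n<N. cmod (of_real \<beta> * d n) * C n) + C'"
  have "D \<ge> 0"
    unfolding D_def using C(1) C'(1) by (intro add_nonneg_nonneg sum_nonneg mult_nonneg_nonneg) auto
  moreover have "cmod ((LINT s:{0<..<h}|lborel. E s * (of_real (v s) powr \<alpha> * of_real (v' s) *
            ((\<Sum>n<N. of_real \<beta> * d n * of_real (v s) ^ n) + of_real (v s) ^ N * k s)))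
         - (\<Sum>n<N. F (e n) * d n)) \<le> D * absolute_line_integral x F"
    if E: "Mellin_representation \<beta> F c E" "x < c" "continuous_on {0<..<h} E" "\<And>s. 0 < s \<Longrightarrow> s < h \<Longrightarrow> cmod (E s) \<le> 1" for F c E
  proof -
    have pow: "of_real (v s) powr \<alpha> * of_real (v s) ^ n = of_real (v s) powr (of_real \<beta> * e n - 1)"
      if "s \<in> {0<..<h}" for s n
      using that v_neq_0[of s] unfolding e by (simp add: powr_add powr_nat algebra_simps)
    have intI: "set_integrable lborel {0<..<h}
        (\<lambda>s. E s * (of_real (v s) powr (of_real \<beta> * e n - 1) * of_real (v' s)))" for n
      using bounded_weight_integrable[OF E(3,4) e_pos, of "\<lambda>_. 1" n] by simp
    define G where "G n = (\<lambda>s. of_real \<beta> * d n *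
        (E s * (of_real (v s) powr (of_real \<beta> * e n - 1) * of_real (v' s))))" for n
    have G_int: "set_integrable lborel {0<..<h} (G n)" for n
      unfolding G_def using intI[of n] by (rule set_integrable_mult_right)
    have G_integral: "(LINT s:{0<..<h}|lborel. G n s) = of_real \<beta> * d n * ?I E n" for n
      unfolding G_def by (rule set_integral_mult_right)
    have sum_G_int: "set_integrable lborel {0<..<h} (\<lambda>s. \<Sum>n<N. G n s)"
      by (rule set_integral_sum(1)) (simp_all add: G_int)
    define H where "H = (\<lambda>s. E s * (of_real (v s) powr (of_real \<beta> * e N - 1) * of_real (v' s) * k s))"
    have H_int: "set_integrable lborel {0<..<h} H"
      unfolding H_def by (rule bounded_weight_integrable[OF E(3,4) e_pos k(1)])
    have integrand: "E s * (of_real (v s) powr \<alpha> * of_real (v' s) *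
            ((\<Sum>n<N. of_real \<beta> * d n * of_real (v s) ^ n) + of_real (v s) ^ N * k s))
        = (\<Sum>n<N. G n s) + H s" if s: "s \<in> {0<..<h}" for s
      unfolding G_def H_def pow[OF s, symmetric] by (simp add: distrib_left sum_distrib_left mult_ac)
    have "(LINT s:{0<..<h}|lborel. E s * (of_real (v s) powr \<alpha> * of_real (v' s) *
            ((\<Sum>n<N. of_real \<beta> * d n * of_real (v s) ^ n) + of_real (v s) ^ N * k s)))
       = (LINT s:{0<..<h}|lborel. (\<Sum>n<N. G n s) + H s)"
      by (rule set_lebesgue_integral_cong) (simp, intro allI impI integrand)
    also have "\<dots> = (LINT s:{0<..<h}|lborel. \<Sum>n<N. G n s) + (LINT s:{0<..<h}|lborel. H s)"
      by (rule set_integral_add(2)[OF sum_G_int H_int])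
    also have "(LINT s:{0<..<h}|lborel. \<Sum>n<N. G n s) = (\<Sum>n<N. LINT s:{0<..<h}|lborel. G n s)"
      by (rule set_integral_sum(2)[OF finite_lessThan G_int])
    finally have split: "(LINT s:{0<..<h}|lborel. E s * (of_real (v s) powr \<alpha> * of_real (v' s) *
            ((\<Sum>n<N. of_real \<beta> * d n * of_real (v s) ^ n) + of_real (v s) ^ N * k s)))
       = (\<Sum>n<N. of_real \<beta> * d n * ?I E n) + ?J E"
      unfolding G_integral H_def .
    have "of_real \<beta> * d n * (?I E n - F (e n) / of_real \<beta>) = of_real \<beta> * d n * ?I E n - F (e n) * d n" for n
      using \<beta> by (simp add: right_diff_distrib)
    then have "cmod ((LINT s:{0<..<h}|lborel. E s * (of_real (v s) powr \<alpha> * of_real (v' s) *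
            ((\<Sum>n<N. of_real \<beta> * d n * of_real (v s) ^ n) + of_real (v s) ^ N * k s)))
         - (\<Sum>n<N. F (e n) * d n))
        = cmod ((\<Sum>n<N. of_real \<beta> * d n * (?I E n - F (e n) / of_real \<beta>)) + ?J E)"
      unfolding split by (simp only: sum_subtractf) (simp only: diff_add_eq)
    also have "\<dots> \<le> cmod (\<Sum>n<N. of_real \<beta> * d n * (?I E n - F (e n) / of_real \<beta>)) + cmod (?J E)"
      by (rule norm_triangle_ineq)
    also have "\<dots> \<le> (\<Sum>n<N. cmod (of_real \<beta> * d n) * (C n * absolute_line_integral x F))
        + C' * absolute_line_integral x F"
    proof (rule add_mono)
      show "cmod (\<Sum>n<N. of_real \<beta> * d n * (?I E n - F (e n) / of_real \<beta>))
          \<le> (\<Sum>n<N. cmod (of_real \<beta> * d n) * (C n * absolute_line_integral x F))"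
      proof (rule sum_norm_le)
        fix n assume "n \<in> {..<N}"
        then have n: "n < N" by simp
        show "cmod (of_real \<beta> * d n * (?I E n - F (e n) / of_real \<beta>))
            \<le> cmod (of_real \<beta> * d n) * (C n * absolute_line_integral x F)"
          unfolding norm_mult[of "of_real \<beta> * d n"]
          by (rule mult_left_mono[OF C(2)[OF n E(1,2)] norm_ge_zero])
      qed
    qed (rule C'(2)[OF E(1,2)])
    also have "\<dots> = D * absolute_line_integral x F"
      unfolding D_def by (simp only: sum_distrib_right distrib_right mult.assoc)
    finally show ?thesis .
  qed
  ultimately show ?thesis by blast
qed

end

section \<open>The local coordinate of a factorized phase\<close>

text \<open>The number \<open>exp (\<i> * \<omega>)\<close> as a real number: the direction in which the segment leaves \<open>t0\<close>.\<close>

definition segment_sign :: "real \<Rightarrow> ereal \<Rightarrow> real" where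
  "segment_sign t0 T = (if T > ereal t0 then 1 else -1)"

lemma segment_sign_eq: "exp (\<i> * of_real (segment_arg t0 T)) = of_real (segment_sign t0 T)"
  "exp (- \<i> * of_real (segment_arg t0 T)) = of_real (segment_sign t0 T)"
  by (simp_all add: segment_sign_def segment_arg_def exp_minus)

lemma segment_sign_cases: "segment_sign t0 T = 1 \<or> segment_sign t0 T = -1"
  by (simp add: segment_sign_def)

lemma segment_near_endpoint:
  assumes T: "T \<noteq> ereal t0"
  shows "\<exists>\<delta>>0. \<forall>s. 0 < s \<and> s < \<delta> \<longrightarrow> t0 + segment_sign t0 T * s \<in> segment t0 T"
proof (cases "T > ereal t0")
  case True
  then obtain m where m: "ereal t0 < ereal m" "ereal m < T" using ereal_dense2 by blast
  have "t0 + s \<in> segment t0 T" if "0 < s" "s < m - t0" for s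
  proof -
    have "ereal (t0 + s) < ereal m" using that by simp
    then have "ereal (t0 + s) < T" using m(2) by (rule less_trans)
    then show ?thesis using that True by (auto simp: segment_def einterval_def)
  qed
  then show ?thesis
    using m True by (intro exI[of _ "m - t0"]) (auto simp: segment_sign_def)
next
  case False
  then have lt: "T < ereal t0" using T by auto
  then obtain m where m: "T < ereal m" "ereal m < ereal t0" using ereal_dense2 by blast
  have "t0 - s \<in> segment t0 T" if "0 < s" "s < t0 - m" for s
  proof -
    have "ereal m < ereal (t0 - s)" using that by simp
    with m(1) have "T < ereal (t0 - s)" by (rule less_trans)
    then show ?thesis using that lt by (auto simp: segment_def einterval_def min_def max_def)
  qed
  then show ?thesis
    using m False by (intro exI[of _ "t0 - m"]) (auto simp: segment_sign_def)
qed

lemma segment_imp_sign: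
  assumes "t \<in> segment t0 T"
  shows "segment_sign t0 T * (t - t0) = \<bar>t - t0\<bar>" "t \<noteq> t0"
  using assms by (auto simp: segment_def einterval_def segment_sign_def min_def max_def split: if_splits)

lemma branch_power_nonzero: "branch_power t0 T \<beta> p \<kappa> w \<noteq> 0"
  by (simp add: branch_power_def)

lemma branch_power_add:
  "branch_power t0 T \<beta> p (\<kappa> + \<mu>) w = branch_power t0 T \<beta> p \<kappa> w * branch_power t0 T \<beta> p \<mu> w"
  by (simp add: branch_power_def exp_add distrib_right)

lemma branch_power_of_nat:
  "branch_power t0 T \<beta> p (of_nat n * \<kappa>) w = branch_power t0 T \<beta> p \<kappa> w ^ n"
  by (simp add: branch_power_def mult.assoc flip: exp_of_nat_mult)

text \<open>On the segment the phases cancel: the argument of \<open>p\<close> is opposite to that of the power of \<open>t - t0\<close>. So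
  \<open>\<psi>\<close> is the power \<open>\<beta>\<close> of the positive number \<open>v\<close>, this \<open>v\<close> is the value of the analytic
  function \<open>(w - t0) * p w powr (1 / \<beta>)\<close>, and all phases in \<open>a\<close> are absorbed by the branch of the power of \<open>p\<close>.\<close>

lemma factorization_moduli:
  assumes F: "factorization_condition t0 T a \<psi> R \<alpha> \<beta> q p" and T: "T \<noteq> ereal t0"
    and t: "t \<in> segment t0 T \<inter> ball t0 R"
  defines "v \<equiv> \<bar>t - t0\<bar> * cmod (p (of_real t)) powr (1 / \<beta>)"
  shows "v > 0" "\<psi> t = v powr \<beta>"
    "of_real (t - t0) * branch_power t0 T \<beta> p (of_real (1 / \<beta>)) (of_real t) = of_real v"
    "a t = of_real v powr \<alpha> * (q (of_real t) / branch_power t0 T \<beta> p (\<alpha> / of_real \<beta>) (of_real t))"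
proof -
  define r s where "r = cmod (p (of_real t))" and "s = \<bar>t - t0\<bar>"
  define \<sigma> \<omega> where "\<sigma> = segment_sign t0 T" and "\<omega> = segment_arg t0 T"
  have \<beta>: "\<beta> > 0" using F by (simp add: factorization_condition_def)
  have r: "r > 0" using factorization_arg(2)[OF F T] t by (auto simp: r_def)
  have s: "s > 0" "t - t0 = \<sigma> * s"
    using segment_imp_sign[of t t0 T] segment_sign_cases[of t0 T] t by (auto simp: s_def \<sigma>_def)
  have v_eq: "v = s * r powr (1 / \<beta>)" by (simp only: v_def s_def r_def)
  show v: "v > 0" unfolding v_eq using r s(1) by simp
  have v_powr: "v powr \<beta> = s powr \<beta> * r"
    using r s(1) \<beta> by (simp add: v_eq powr_mult powr_powr)
  have F_a: "a t = segment_power t0 T \<alpha> t * q (of_real t)"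
    and F_\<psi>: "of_real (\<psi> t) = segment_power t0 T (of_real \<beta>) t * p (of_real t)"
    using F t by (auto simp: factorization_condition_def)
  note F_\<psi>
  also have "p (of_real t) = of_real r * exp (- \<i> * of_real (\<beta> * \<omega>))"
    using factorization_arg(1)[OF F T, of t] t by (simp add: r_def \<omega>_def)
  also have "segment_power t0 T (of_real \<beta>) t = of_real (s powr \<beta>) * exp (\<i> * of_real (\<beta> * \<omega>))"
    using s(1) powr_of_real[of s \<beta>] by (simp add: segment_power_def mult.assoc flip: s_def \<omega>_def)
  also have "of_real (s powr \<beta>) * exp (\<i> * of_real (\<beta> * \<omega>)) * (of_real r * exp (- \<i> * of_real (\<beta> * \<omega>)))
      = complex_of_real (s powr \<beta> * r)"
    by (simp add: exp_minus divide_inverse[symmetric])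
  finally show "\<psi> t = v powr \<beta>" unfolding v_powr of_real_eq_iff .
  have B: "branch_power t0 T \<beta> p \<kappa> (of_real t) = of_real r powr \<kappa> * exp (- \<i> * \<kappa> * of_real (\<beta> * \<omega>))" for \<kappa>
    using branch_power_on_segment[OF F T, of t] t by (simp add: r_def \<omega>_def)
  have "branch_power t0 T \<beta> p (of_real (1 / \<beta>)) (of_real t) = of_real (r powr (1 / \<beta>)) * of_real \<sigma>"
    unfolding B using r \<beta> segment_sign_eq(2)[of t0 T] powr_of_real[of r "1 / \<beta>"]
    by (simp add: \<omega>_def \<sigma>_def)
  then show "of_real (t - t0) * branch_power t0 T \<beta> p (of_real (1 / \<beta>)) (of_real t) = of_real v"
    using s(2) segment_sign_cases[of t0 T] by (auto simp: v_eq \<sigma>_def)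
  have v_\<alpha>: "of_real v powr \<alpha> = of_real s powr \<alpha> * of_real r powr (\<alpha> / of_real \<beta>)"
  proof -
    have "complex_of_real (r powr (1 / \<beta>)) powr \<alpha> = exp (\<alpha> * of_real (ln (r powr (1 / \<beta>))))"
      unfolding powr_def using r by (simp add: Ln_of_real)
    also have "\<dots> = exp (\<alpha> / of_real \<beta> * of_real (ln r))"
      using r by (simp add: ln_powr)
    also have "\<dots> = of_real r powr (\<alpha> / of_real \<beta>)"
      unfolding powr_def using r by (simp add: Ln_of_real)
    finally show ?thesis
      unfolding v_eq of_real_mult using s(1) by (subst powr_times_real) auto
  qed
  have bp: "branch_power t0 T \<beta> p (\<alpha> / of_real \<beta>) (of_real t) =
      of_real r powr (\<alpha> / of_real \<beta>) * inverse (exp (\<i> * \<alpha> * of_real \<omega>))"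
  proof -
    have "- \<i> * (\<alpha> / of_real \<beta>) * of_real (\<beta> * \<omega>) = - (\<i> * \<alpha> * of_real \<omega>)"
      using \<beta> by simp
    then show ?thesis unfolding B by (simp only: exp_minus)
  qed
  have at: "a t = of_real s powr \<alpha> * exp (\<i> * \<alpha> * of_real \<omega>) * q (of_real t)"
    unfolding F_a segment_power_def s_def \<omega>_def ..
  have cancel: "A * E * z = A * P * (z / (P * inverse E))" if "P \<noteq> 0" "E \<noteq> 0" for A E P z :: complex
    using that by (simp add: field_simps)
  show "a t = of_real v powr \<alpha> * (q (of_real t) / branch_power t0 T \<beta> p (\<alpha> / of_real \<beta>) (of_real t))"
    unfolding at v_\<alpha> bp by (rule cancel) (use r in auto)
qed

text \<open>The direction \<open>\<sigma>\<close> compensates the argument \<open>- \<omega>\<close> of \<open>p powr (1 / \<beta>)\<close>. Hence the coordinate increases along the segment at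
  \<open>t0\<close>.\<close>

lemma branch_power_at_endpoint:
  assumes F: "factorization_condition t0 T a \<psi> R \<alpha> \<beta> q p" and T: "T \<noteq> ereal t0"
  shows "of_real (segment_sign t0 T) * branch_power t0 T \<beta> p (of_real (1 / \<beta>)) (of_real t0)
     = of_real (cmod (p (of_real t0)) powr (1 / \<beta>))"
proof -
  have \<beta>: "\<beta> > 0" and p0: "p (of_real t0) \<noteq> 0" using F by (auto simp: factorization_condition_def)
  have "branch_power t0 T \<beta> p (of_real (1 / \<beta>)) (of_real t0) =
      of_real (cmod (p (of_real t0)) powr (1 / \<beta>)) * of_real (segment_sign t0 T)"
    using branch_power_on_segment[OF F T, of t0 "of_real (1 / \<beta>)"] \<beta> p0 segment_sign_eq(2)[of t0 T]
      powr_of_real[of "cmod (p (of_real t0))" "1 / \<beta>"]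
    by simp
  then show ?thesis using segment_sign_cases[of t0 T] by auto
qed

text \<open>The exponents of \<open>p\<close> add up: \<open>\<chi>\<^sub>n = \<alpha> / \<beta> + (n + 1) / \<beta>\<close>. So the coefficients of the theorem are those of
  \<open>Lagrange_expansion\<close>, up to the factor \<open>\<beta>\<close>.\<close>

lemma segment_coeff_eq:
  "of_real \<beta> * segment_coeff t0 T \<alpha> \<beta> q p n =
     (deriv ^^ n) (\<lambda>w. q w / branch_power t0 T \<beta> p (\<alpha> / of_real \<beta>) w /
        branch_power t0 T \<beta> p (of_real (1 / \<beta>)) w ^ (n + 1)) (of_real t0) / fact n"
  if "\<beta> \<noteq> 0"
proof -
  have "chi_exponent \<alpha> \<beta> n = \<alpha> / of_real \<beta> + of_nat (n + 1) * of_real (1 / \<beta>)"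
    by (simp add: chi_exponent_def add_divide_distrib)
  then have "branch_power t0 T \<beta> p (chi_exponent \<alpha> \<beta> n) w =
     branch_power t0 T \<beta> p (\<alpha> / of_real \<beta>) w * branch_power t0 T \<beta> p (of_real (1 / \<beta>)) w ^ (n + 1)" for w
    by (simp only: branch_power_add branch_power_of_nat)
  then show ?thesis using that by (simp add: segment_coeff_def)
qed

text \<open>Combines \<open>Lagrange_expansion\<close> with the positivity of \<open>V\<close> on the segment. The expansion holds in a complex disc; restricting it
  to \<open>w = t0 + \<sigma> * s\<close> gives the expansion in the real coordinate, and the chain rule turns \<open>\<sigma> * V'\<close> into \<open>v'\<close>.\<close>

lemma local_phase_coordinate:
  assumes F: "factorization_condition t0 T a \<psi> R \<alpha> \<beta> q p" and T: "T \<noteq> ereal t0"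
  defines "\<sigma> \<equiv> segment_sign t0 T"
  shows "\<exists>h v v' k k'. phase_coordinate h v v' \<and>
    continuous_on {0..h} k \<and> continuous_on {0..h} k' \<and>
    (\<forall>s. 0 < s \<and> s < h \<longrightarrow> (k has_vector_derivative k' s) (at s) \<and>
       t0 + \<sigma> * s \<in> segment t0 T \<and> \<psi> (t0 + \<sigma> * s) = v s powr \<beta> \<and>
       a (t0 + \<sigma> * s) = of_real \<sigma> * (of_real (v s) powr \<alpha> * of_real (v' s) *
         ((\<Sum>n<N. of_real \<beta> * segment_coeff t0 T \<alpha> \<beta> q p n * of_real (v s) ^ n)
           + of_real (v s) ^ N * k s)))"
proof -
  have R: "R > 0" and \<beta>: "\<beta> > 0" and q: "q analytic_on ball (of_real t0) R"
    and p0: "p (of_real t0) \<noteq> 0"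
    using F by (auto simp: factorization_condition_def)
  define c where "c = complex_of_real t0"
  define B where "B = branch_power t0 T \<beta> p (of_real (1 / \<beta>))"
  define Q where "Q w = q w / branch_power t0 T \<beta> p (\<alpha> / of_real \<beta>) w" for w
  define V where "V w = (w - c) * B w" for w
  have B0: "B w \<noteq> 0" for w by (simp add: B_def branch_power_nonzero)
  have B_an: "B analytic_on {c}"
    unfolding B_def c_def by (rule branch_power_analytic[OF F])
  have "q analytic_on {c}"
    using q R by (auto simp: c_def elim: analytic_on_subset)
  then have Q_an: "Q analytic_on {c}"
    unfolding Q_def c_def
    by (intro analytic_on_divide branch_power_analytic[OF F] branch_power_nonzero)
  obtain r1 where r1: "r1 > 0" "B holomorphic_on ball c r1" using B_an by (auto simp: analytic_on_def)
  obtain r2 where r2: "r2 > 0" "Q holomorphic_on ball c r2" using Q_an by (auto simp: analytic_on_def)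
  have V_hol: "V holomorphic_on ball c r1"
    unfolding V_def by (intro holomorphic_intros r1)
  have "(V has_field_derivative B c) (at c)"
  proof -
    have "(B has_field_derivative deriv B c) (at c)"
      using r1 by (intro holomorphic_derivI[of _ "ball c r1"]) auto
    then show ?thesis unfolding V_def by (auto intro!: derivative_eq_intros)
  qed
  then have "of_real \<sigma> * deriv V c = of_real (cmod (p c) powr (1 / \<beta>))"
    using branch_power_at_endpoint[OF F T] by (simp add: DERIV_imp_deriv B_def c_def \<sigma>_def)
  then have "Re (of_real \<sigma> * deriv V c) > 0"
    using p0 by (simp add: c_def)
  moreover have V'_hol: "deriv V holomorphic_on ball c r1"
    using V_hol by (rule holomorphic_deriv) simp
  then have "isCont (deriv V) c"
    using r1 holomorphic_on_imp_continuous_on[OF V'_hol] by (simp add: continuous_on_eq_continuous_at)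
  then have "((\<lambda>w. Re (of_real \<sigma> * deriv V w)) \<longlongrightarrow> Re (of_real \<sigma> * deriv V c)) (nhds c)"
    unfolding isCont_def tendsto_at_iff_tendsto_nhds by (intro tendsto_intros)
  ultimately have "\<forall>\<^sub>F w in nhds c. Re (of_real \<sigma> * deriv V w) > 0"
    using order_tendstoD(1) by blast
  then obtain r3 where r3: "r3 > 0" "\<And>w. w \<in> ball c r3 \<Longrightarrow> Re (of_real \<sigma> * deriv V w) > 0"
    by (auto simp: eventually_nhds_metric dist_commute)
  define r where "r = min (min r1 r2) r3"
  have r: "r > 0" "r \<le> r1" "r \<le> r2" "r \<le> r3" using r1 r2 r3 by (auto simp: r_def)
  have hol: "B holomorphic_on ball c r" "Q holomorphic_on ball c r" "V holomorphic_on ball c r"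
    using r by (auto intro: holomorphic_on_subset[OF r1(2)] holomorphic_on_subset[OF r2(2)]
        holomorphic_on_subset[OF V_hol])
  have V'_pos: "Re (of_real \<sigma> * deriv V w) > 0" if "w \<in> ball c r" for w
    using that r r3 by auto
  then have V'0: "deriv V w \<noteq> 0" if "w \<in> ball c r" for w using that by fastforce
  obtain K where K: "K holomorphic_on ball c r" and Q_eq: "\<And>w. w \<in> ball c r \<Longrightarrow>
    Q w = deriv V w * ((\<Sum>n<N. of_real \<beta> * segment_coeff t0 T \<alpha> \<beta> q p n * V w ^ n) + V w ^ N * K w)"
    using Lagrange_expansion[OF r(1) hol(2,1), of N] B0 V'0 \<beta>
    unfolding segment_coeff_eq[OF less_imp_neq[OF \<beta>, symmetric]] V_def Q_def B_def c_def by blast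
  obtain \<delta> where \<delta>: "\<delta> > 0" "\<And>s. 0 < s \<Longrightarrow> s < \<delta> \<Longrightarrow> t0 + \<sigma> * s \<in> segment t0 T"
    using segment_near_endpoint[OF T] by (auto simp: \<sigma>_def)
  define h where "h = min \<delta> (min R r) / 2"
  have h: "h > 0" "h < \<delta>" "h < R" "h < r" using \<delta> R r by (auto simp: h_def)
  define \<tau> where "\<tau> s = complex_of_real (t0 + \<sigma> * s)" for s
  have \<sigma>: "\<bar>\<sigma>\<bar> = 1" "\<sigma> * \<sigma> = 1" using segment_sign_cases[of t0 T] by (auto simp: \<sigma>_def)
  have dist_\<tau>: "dist c (\<tau> s) = \<bar>s\<bar>" for s
    unfolding c_def \<tau>_def dist_of_real using \<sigma> by (simp add: dist_real_def abs_mult)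
  have \<tau>_in: "\<tau> s \<in> ball c r" if "0 \<le> s" "s \<le> h" for s
    using that h by (simp add: dist_\<tau>)
  have t_in: "t0 + \<sigma> * s \<in> segment t0 T \<inter> ball t0 R" if "0 < s" "s \<le> h" for s
    using \<delta>(2)[of s] that h \<sigma> by (simp add: dist_norm abs_mult)
  define v where "v s = Re (V (\<tau> s))" for s
  define v' where "v' s = Re (of_real \<sigma> * deriv V (\<tau> s))" for s
  define k where "k s = K (\<tau> s)" for s
  define k' where "k' s = of_real \<sigma> * deriv K (\<tau> s)" for s
  have \<tau>_cont: "continuous_on A \<tau>" for A unfolding \<tau>_def by (intro continuous_intros)
  have \<tau>_deriv: "(\<tau> has_vector_derivative of_real \<sigma>) (at s)" for s
    unfolding \<tau>_def has_vector_derivative_def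
    by (auto intro!: derivative_eq_intros simp: scaleR_conv_of_real)
  have comp_cont: "continuous_on {0..h} (\<lambda>s. f (\<tau> s))" if "f holomorphic_on ball c r" for f
    using holomorphic_on_imp_continuous_on[OF that] \<tau>_cont
    by (rule continuous_on_compose2) (use \<tau>_in in auto)
  have comp_deriv: "((\<lambda>s. f (\<tau> s)) has_vector_derivative of_real \<sigma> * deriv f (\<tau> s)) (at s)"
    if "f holomorphic_on ball c r" "0 \<le> s" "s \<le> h" for f s
    using field_vector_diff_chain_at[OF \<tau>_deriv holomorphic_derivI[OF that(1) _ \<tau>_in[OF that(2,3)]]]
    by (simp add: o_def)
  have V_on: "V (\<tau> s) = of_real (v s) \<and> v s > 0 \<and> \<psi> (t0 + \<sigma> * s) = v s powr \<beta> \<and>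
      a (t0 + \<sigma> * s) = of_real (v s) powr \<alpha> * Q (\<tau> s)" if s: "0 < s" "s \<le> h" for s
  proof -
    note fm = factorization_moduli[OF F T t_in[OF s]]
    have "V (\<tau> s) = of_real (\<bar>t0 + \<sigma> * s - t0\<bar> * cmod (p (of_real (t0 + \<sigma> * s))) powr (1 / \<beta>))"
      using fm(3) by (simp only: V_def B_def c_def \<tau>_def of_real_diff)
    moreover from this have "v s = \<bar>t0 + \<sigma> * s - t0\<bar> * cmod (p (of_real (t0 + \<sigma> * s))) powr (1 / \<beta>)"
      by (simp only: v_def Re_complex_of_real)
    ultimately show ?thesis
      using fm(1,2,4) unfolding Q_def \<tau>_def by simp
  qed
  \<comment> \<open>\<open>V\<close> is real along the segment, so its derivative along the segment is real as well\<close>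
  have V'_real: "of_real \<sigma> * deriv V (\<tau> s) = of_real (v' s)" if s: "0 < s" "s < h" for s
  proof -
    have "((\<lambda>s. Im (V (\<tau> s))) has_vector_derivative Im (of_real \<sigma> * deriv V (\<tau> s))) (at s)"
      using comp_deriv[OF hol(3), of s] s by (intro bounded_linear.has_vector_derivative[OF bounded_linear_Im]) auto
    moreover have "((\<lambda>s. Im (V (\<tau> s))) has_vector_derivative 0) (at s)"
    proof (rule has_vector_derivative_transform_within_open[of "\<lambda>_. 0" _ _ "{0<..<h}"])
      show "0 = Im (V (\<tau> u))" if "u \<in> {0<..<h}" for u
        using V_on[of u] that by simp
    qed (use s in auto)
    ultimately have "Im (of_real \<sigma> * deriv V (\<tau> s)) = 0"
      by (rule vector_derivative_unique_at)
    then show ?thesis by (simp add: complex_eq_iff v'_def)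
  qed
  have phase: "phase_coordinate h v v'"
  proof
    show "continuous_on {0..h} v"
      unfolding v_def by (intro continuous_intros comp_cont hol)
    show "v 0 = 0" by (simp add: v_def V_def \<tau>_def c_def)
    show "v s > 0" if "0 < s" "s \<le> h" for s using V_on[OF that] by simp
    show "(v has_real_derivative v' s) (at s)" if "0 < s" "s < h" for s
      unfolding has_real_derivative_iff_has_vector_derivative v_def v'_def
      using comp_deriv[OF hol(3), of s] that by (intro bounded_linear.has_vector_derivative[OF bounded_linear_Re]) auto
    show "v' s \<ge> 0" if "0 < s" "s < h" for s
      using V'_pos[OF \<tau>_in[of s]] that by (simp add: v'_def)
    show "continuous_on {0<..<h} v'"
      unfolding v'_def
      by (intro continuous_intros continuous_on_subset[OF comp_cont]
          holomorphic_deriv[OF hol(3)]) auto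
  qed (use h in auto)
  have k: "continuous_on {0..h} k" "continuous_on {0..h} k'"
    unfolding k_def k'_def
    by (intro continuous_intros comp_cont K holomorphic_deriv[OF K] open_ball)+
  have "(k has_vector_derivative k' s) (at s) \<and>
       t0 + \<sigma> * s \<in> segment t0 T \<and> \<psi> (t0 + \<sigma> * s) = v s powr \<beta> \<and>
       a (t0 + \<sigma> * s) = of_real \<sigma> * (of_real (v s) powr \<alpha> * of_real (v' s) *
         ((\<Sum>n<N. of_real \<beta> * segment_coeff t0 T \<alpha> \<beta> q p n * of_real (v s) ^ n)
           + of_real (v s) ^ N * k s))" if s: "0 < s" "s < h" for s
  proof -
    have V': "deriv V (\<tau> s) = of_real \<sigma> * of_real (v' s)"
      unfolding V'_real[OF s, symmetric] mult.assoc[symmetric] of_real_mult[symmetric] \<sigma>(2) by simp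
    have V: "V (\<tau> s) = of_real (v s)" using V_on[of s] s by simp
    have "a (t0 + \<sigma> * s) = of_real (v s) powr \<alpha> * Q (\<tau> s)"
      using V_on[of s] s by simp
    also have "Q (\<tau> s) = of_real \<sigma> * of_real (v' s) *
       ((\<Sum>n<N. of_real \<beta> * segment_coeff t0 T \<alpha> \<beta> q p n * of_real (v s) ^ n) + of_real (v s) ^ N * k s)"
      using Q_eq[OF \<tau>_in[of s]] s unfolding V V' k_def by simp
    finally show ?thesis
      using V_on[of s] comp_deriv[OF K, of s] t_in[of s] s unfolding k_def k'_def
      by (simp add: mult_ac)
  qed
  with phase k show ?thesis by blast
qed

section \<open>The part of the integral away from the endpoint\<close>

lemma segment_open: "open (segment t0 T)"
  by (simp add: segment_def)

lemma segment_measurable: "segment t0 T \<in> sets borel"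
  using segment_open by (rule borel_open)

text \<open>The part of the segment at distance at least \<open>h\<close> from \<open>t0\<close>, together with the endpoint \<open>T\<close>, is a compact interval of
  extended real numbers, whether \<open>T\<close> is finite or not. Extended by its limit at \<open>T\<close>, the phase attains its minimum
  there.\<close>

lemma phase_gap:
  fixes \<phi> :: "real \<Rightarrow> real" and \<phi>_T :: ereal
  assumes T: "T \<noteq> ereal t0" and cont: "continuous_on (segment t0 T) \<phi>"
    and lim: "((\<lambda>x. ereal (\<phi> (real_of_ereal x))) \<longlongrightarrow> \<phi>_T) (at T within ereal ` segment t0 T)"
    and above: "\<And>t. t \<in> segment t0 T \<Longrightarrow> \<phi> t > b" and above_T: "\<phi>_T > ereal b" and h: "h > 0"
  shows "\<exists>c>b. \<forall>t\<in>segment t0 T. \<bar>t - t0\<bar> \<ge> h \<longrightarrow> \<phi> t \<ge> c"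
proof -
  define g where "g x = (if x = T then \<phi>_T else ereal (\<phi> (real_of_ereal x)))" for x
  define K where "K = (if T > ereal t0 then {ereal (t0 + h)..T} else {T..ereal (t0 - h)})"
  have "closed K" by (simp add: K_def)
  then have "compact K" by (simp only: compact_eq_closed)
  have K_sub: "K \<subseteq> insert T (ereal ` segment t0 T)"
  proof
    fix x assume x: "x \<in> K"
    show "x \<in> insert T (ereal ` segment t0 T)"
    proof (cases "x = T")
      case False
      then have "min (ereal t0) T < x" "x < max (ereal t0) T"
        using x h T by (auto simp: K_def min_def max_def split: if_splits
            intro: less_le_trans[of _ "ereal (t0 + h)"] le_less_trans[of _ "ereal (t0 - h)"])
      then show ?thesis
        by (cases x) (auto simp: segment_def einterval_def)
    qed simp
  qed
  have inK: "ereal t \<in> K" if "t \<in> segment t0 T" "\<bar>t - t0\<bar> \<ge> h" for t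
    using that T h by (auto simp: K_def segment_def einterval_def min_def max_def split: if_splits)
  have gt: "g x > ereal b" if "x \<in> K" for x
    using that K_sub above above_T by (auto simp: g_def)
  have "continuous_on K g"
    unfolding continuous_on_def
  proof
    fix x assume x: "x \<in> K"
    show "(g \<longlongrightarrow> g x) (at x within K)"
    proof (cases "x = T")
      case True
      have "((\<lambda>x. ereal (\<phi> (real_of_ereal x))) \<longlongrightarrow> \<phi>_T) (at T within K - {T})"
        using lim by (rule tendsto_within_subset) (use K_sub in auto)
      also have "at T within K - {T} = at T within K"
        by (simp add: at_within_def)
      finally have "((\<lambda>x. ereal (\<phi> (real_of_ereal x))) \<longlongrightarrow> \<phi>_T) (at T within K)" .
      moreover have "\<forall>\<^sub>F y in at T within K. ereal (\<phi> (real_of_ereal y)) = g y"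
        by (auto simp: g_def eventually_at_filter)
      ultimately show ?thesis
        unfolding True by (auto simp: g_def intro: Lim_transform_eventually)
    next
      case False
      then obtain t where t: "x = ereal t" "t \<in> segment t0 T" using x K_sub by auto
      have "isCont \<phi> t" using cont t(2) segment_open by (simp add: continuous_on_eq_continuous_at)
      then have "((\<lambda>y. ereal (\<phi> (real_of_ereal y))) \<longlongrightarrow> ereal (\<phi> t)) (at x within K)"
        unfolding t(1) by (intro tendsto_ereal isCont_tendsto_compose[of _ \<phi>] lim_real_of_ereal tendsto_ident_at)
      moreover have "\<forall>\<^sub>F y in at x within K. ereal (\<phi> (real_of_ereal y)) = g y"
        unfolding eventually_at_filter using t1_space_nhds[OF False]
        by (rule eventually_mono) (simp add: g_def)
      ultimately show ?thesis
        using False t by (auto simp: g_def intro: Lim_transform_eventually)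
    qed
  qed
  show ?thesis
  proof (cases "K = {}")
    case True
    then show ?thesis using inK by (intro exI[of _ "b + 1"]) auto
  next
    case False
    obtain x where x: "x \<in> K" "\<And>y. y \<in> K \<Longrightarrow> g x \<le> g y"
      using continuous_attains_inf[OF \<open>compact K\<close> False \<open>continuous_on K g\<close>] by blast
    obtain c where c: "ereal b < ereal c" "ereal c < g x"
      using ereal_dense2[OF gt[OF x(1)]] by auto
    have "\<phi> t \<ge> c" if t: "t \<in> segment t0 T" "\<bar>t - t0\<bar> \<ge> h" for t
    proof -
      have "ereal t \<noteq> T" using t by (auto simp: segment_def einterval_def min_def max_def split: if_splits)
      then have "g (ereal t) = ereal (\<phi> t)" by (simp add: g_def)
      then have "ereal c < ereal (\<phi> t)" using c(2) x(2)[OF inK[OF t]] by (metis less_le_trans)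
      then show ?thesis by simp
    qed
    then show ?thesis using c by auto
  qed
qed

lemma exponential_integral_integrable:
  fixes a :: "real \<Rightarrow> complex"
  assumes S: "S \<in> sets borel" "continuous_on S \<phi>" "continuous_on S a"
    and pos: "\<And>t. t \<in> S \<Longrightarrow> \<phi> t \<ge> 0"
    and int: "set_integrable lborel S (\<lambda>t. exp (- l0 * \<phi> t) * cmod (a t))" and l: "l \<ge> l0"
  shows "set_integrable lborel S (\<lambda>t. exp (- of_real (l * \<phi> t)) * a t)"
  using int
proof (rule set_integrable_bound)
  show "set_borel_measurable lborel S (\<lambda>t. exp (- of_real (l * \<phi> t)) * a t)"
    unfolding set_borel_measurable_def measurable_lborel2
    by (intro borel_measurable_continuous_on_indicator continuous_intros S)
  have "norm (exp (- of_real (l * \<phi> t)) * a t) \<le> norm (exp (- l0 * \<phi> t) * cmod (a t))"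
    if "t \<in> S" for t
    using pos[OF that] l by (auto simp: norm_mult abs_mult intro!: mult_right_mono)
  then show "AE t in lborel. t \<in> S \<longrightarrow>
      norm (exp (- of_real (l * \<phi> t)) * a t) \<le> norm (exp (- l0 * \<phi> t) * cmod (a t))"
    by (intro AE_I2) auto
qed

text \<open>For \<open>l \<ge> l0\<close> split \<open>exp (- l * \<phi>) = exp (- (l - l0) * \<phi>) * exp (- l0 * \<phi>)\<close>: the first factor is at most
  \<open>exp (- (l - l0) * c)\<close>, and the second makes the integral converge.\<close>

lemma tail_integral_bound:
  fixes a :: "real \<Rightarrow> complex"
  assumes S: "S \<in> sets borel" "continuous_on S \<phi>" "continuous_on S a"
    and pos: "\<And>t. t \<in> S \<Longrightarrow> \<phi> t \<ge> 0"
    and int: "set_integrable lborel S (\<lambda>t. exp (- l0 * \<phi> t) * cmod (a t))" and l: "l \<ge> l0"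
    and A: "A \<in> sets borel" "A \<subseteq> S" and c: "\<And>t. t \<in> A \<Longrightarrow> \<phi> t \<ge> c"
  shows "cmod (LINT t:A|lborel. exp (- of_real (l * \<phi> t)) * a t)
     \<le> exp (l0 * c) * (LINT t:A|lborel. exp (- l0 * \<phi> t) * cmod (a t)) * exp (- c * l)"
proof -
  have int_A: "set_integrable lborel A (\<lambda>t. exp (- l0 * \<phi> t) * cmod (a t))"
    "set_integrable lborel A (\<lambda>t. exp (- of_real (l * \<phi> t)) * a t)"
    using exponential_integral_integrable[OF S pos int l] int A
    by (auto intro: set_integrable_subset)
  have "cmod (LINT t:A|lborel. exp (- of_real (l * \<phi> t)) * a t)
      \<le> (LINT t:A|lborel. cmod (exp (- of_real (l * \<phi> t)) * a t))"
    by (rule set_integral_norm_bound[OF int_A(2)])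
  also have "\<dots> \<le> (LINT t:A|lborel. exp (- (l - l0) * c) * (exp (- l0 * \<phi> t) * cmod (a t)))"
  proof (rule set_integral_mono)
    show "cmod (exp (- of_real (l * \<phi> t)) * a t) \<le> exp (- (l - l0) * c) * (exp (- l0 * \<phi> t) * cmod (a t))"
      if "t \<in> A" for t
    proof -
      have "(l - l0) * c \<le> (l - l0) * \<phi> t"
        using l c[OF that] by (intro mult_left_mono) auto
      then have "exp (- (l * \<phi> t)) \<le> exp (- (l - l0) * c) * exp (- l0 * \<phi> t)"
        unfolding exp_add[symmetric] by (simp add: algebra_simps)
      then show ?thesis
        by (simp add: norm_mult mult_right_mono flip: mult.assoc)
    qed
  qed (use int_A in \<open>auto intro!: set_integrable_mult_right set_integrable_norm\<close>)
  also have "\<dots> = exp (- (l - l0) * c) * (LINT t:A|lborel. exp (- l0 * \<phi> t) * cmod (a t))"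
    by (rule set_integral_mult_right)
  also have "exp (- (l - l0) * c) = exp (l0 * c) * exp (- c * l)"
    unfolding exp_add[symmetric] by (simp add: algebra_simps)
  finally show ?thesis by (simp add: mult_ac)
qed

section \<open>The asymptotic expansion\<close>

lemma complex_powr_powr:
  assumes "x > 0"
  shows "complex_of_real (x powr \<beta>) powr w = of_real x powr (of_real \<beta> * w)"
proof -
  have "complex_of_real (x powr \<beta>) powr w = exp (w * of_real (ln (x powr \<beta>)))"
    unfolding powr_def using assms by (simp add: Ln_of_real)
  also have "\<dots> = exp (of_real \<beta> * w * of_real (ln x))"
    using assms by (simp add: ln_powr mult.assoc mult.left_commute)
  also have "\<dots> = of_real x powr (of_real \<beta> * w)"
    unfolding powr_def using assms by (simp add: Ln_of_real)
  finally show ?thesis .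
qed

lemma integral_over_near_part:
  fixes f :: "real \<Rightarrow> complex"
  assumes "\<bar>\<sigma>\<bar> = 1"
  shows "(LINT t:(\<lambda>s. t0 + \<sigma> * s) ` {0<..<h}|lborel. f t) = (LINT s:{0<..<h}|lborel. f (t0 + \<sigma> * s))"
proof -
  let ?A = "(\<lambda>s. t0 + \<sigma> * s) ` {0<..<h}"
  have "\<sigma> \<noteq> 0" using assms by auto
  then have "t0 + \<sigma> * s \<in> ?A \<longleftrightarrow> s \<in> {0<..<h}" for s
    by (intro inj_image_mem_iff injI) simp
  then have ind: "indicator ?A (t0 + \<sigma> * s) = (indicator {0<..<h} s :: real)" for s
    unfolding indicator_def by simp
  show ?thesis
    unfolding set_lebesgue_integral_def
      lborel_integral_real_affine[OF \<open>\<sigma> \<noteq> 0\<close>, of "\<lambda>t. indicator ?A t *\<^sub>R f t" t0] ind assms scaleR_one ..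
qed

theorem theorem4p1:
  fixes t0 :: real and T :: ereal and \<phi> \<psi> :: "real \<Rightarrow> real" and a :: "real \<Rightarrow> complex"
    and \<phi>_t0 :: real and \<phi>_T :: ereal and l0 :: real
    and R \<beta> :: real and \<alpha> :: complex and q p :: "complex \<Rightarrow> complex"
    and \<Phi> :: "complex \<Rightarrow> real \<Rightarrow> complex"
  assumes "T \<noteq> ereal t0"
    and "continuous_on (segment t0 T) \<phi>" and "\<forall>t \<in> segment t0 T. \<phi> t > 0"
    and "continuous_on (segment t0 T) a"
    and "(\<phi> \<longlongrightarrow> \<phi>_t0) (at t0 within segment t0 T)"
    and "((\<lambda>x. ereal (\<phi> (real_of_ereal x))) \<longlongrightarrow> \<phi>_T) (at T within ereal ` segment t0 T)"
    and "\<phi>_t0 \<ge> 0" and "\<forall>t \<in> segment t0 T. \<phi> t > \<phi>_t0" and "\<phi>_T > ereal \<phi>_t0"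
    and "l0 \<ge> 0"
    and "set_integrable lborel (segment t0 T) (\<lambda>t. exp (- l0 * \<phi> t) * cmod (a t))"
    and "\<forall>t \<in> segment t0 T. \<psi> t > 0"
    and "factorization_condition t0 T a \<psi> R \<alpha> \<beta> q p"
    and "kernel_condition (segment t0 T) \<phi> \<psi> \<Phi>"
  shows "scale_expansion
    (\<lambda>l. LINT t:segment t0 T|lborel. exp (- of_real (l * \<phi> t)) * a t) \<Phi>
    (chi_exponent \<alpha> \<beta>)
    (\<lambda>n. exp (\<i> * of_real (segment_arg t0 T)) * segment_coeff t0 T \<alpha> \<beta> q p n)"
  unfolding scale_expansion_def
proof (intro allI impI)
  fix N :: nat assume N: "N \<ge> 1"
  note T = assms(1) and \<phi>_cont = assms(2) and a_cont = assms(4) and int = assms(11) and F = assms(13)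
  have \<phi>_pos: "\<phi> t > 0" if "t \<in> segment t0 T" for t using assms(3) that by blast
  have \<beta>: "\<beta> > 0" and \<alpha>: "Re \<alpha> > -1" using F by (auto simp: factorization_condition_def)
  obtain \<zeta> :: "real \<Rightarrow> real" where \<zeta>: "filterlim \<zeta> at_top at_top"
    and K1: "\<forall>l>0. \<forall>x. 0 < x \<and> x < \<zeta> l \<longrightarrow> (\<forall>t\<in>segment t0 T.
        exp (- of_real (l * \<phi> t)) = 1 / (2 * of_real pi * \<i>) *
          vertical_line_integral x (\<lambda>z. \<Phi> z l * of_real (\<psi> t) powr (- z)))"
    and K2: "\<forall>l>0. (\<lambda>z. \<Phi> z l) holomorphic_on vertical_strip 0 (\<zeta> l) \<and>
        (\<lambda>z. \<Phi> z l) \<in> O[strip_ends 0 (\<zeta> l)](\<lambda>z. of_real (1 / (cmod z)\<^sup>2))"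
    and K3: "\<forall>z1 z2. 0 < Re z1 \<and> Re z1 < Re z2 \<longrightarrow> (\<lambda>l. \<Phi> z2 l) \<in> o[at_top](\<lambda>l. \<Phi> z1 l)"
    and K4: "\<forall>x>0. (\<lambda>l. of_real (LINT y|lborel. cmod (\<Phi> (Complex x y) l) / cmod (Complex x y)))
         \<in> O[at_top](\<lambda>l. \<Phi> (of_real x) l)"
    and K5: "\<forall>c>0. \<forall>z. Re z > 0 \<longrightarrow> (\<lambda>l. of_real (exp (- c * l))) \<in> o[at_top](\<lambda>l. \<Phi> z l)"
    using assms(14) unfolding kernel_condition_def by (elim exE conjE) (rule that)
  have Mellin: "exp (- of_real (l * \<phi> t)) = 1 / (2 * of_real pi * \<i>) *
          vertical_line_integral x (\<lambda>z. \<Phi> z l * of_real (\<psi> t) powr (- z))"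
    if "l > 0" "0 < x" "x < \<zeta> l" "t \<in> segment t0 T" for l x t
    by (rule K1[rule_format, OF that(1) conjI[OF that(2,3)] that(4)])
  have \<Phi>_scale: "(\<lambda>l. \<Phi> z2 l) \<in> o[at_top](\<lambda>l. \<Phi> z1 l)" if "0 < Re z1" "Re z1 < Re z2" for z1 z2
    by (rule K3[rule_format, OF conjI[OF that]])
  define \<sigma> where "\<sigma> = segment_sign t0 T"
  define d where "d = segment_coeff t0 T \<alpha> \<beta> q p"
  define e where "e = chi_exponent \<alpha> \<beta>"
  have e_eq: "of_real \<beta> * e n = \<alpha> + 1 + of_nat n" for n
    using \<beta> by (simp add: e_def chi_exponent_def)
  have Re_e: "Re (e n) = (Re \<alpha> + 1 + real n) / \<beta>" for n
    by (simp add: e_def chi_exponent_def)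
  have e_pos: "Re (e n) > 0" for n
    using \<alpha> \<beta> by (simp add: Re_e)
  have e_mono: "Re (e m) \<le> Re (e n)" if "m \<le> n" for m n
    using \<beta> that by (simp add: Re_e divide_right_mono)
  have e_less: "Re (e (N - 1)) < Re (e N)"
    using \<beta> N by (simp add: Re_e divide_strict_right_mono)
  \<comment> \<open>the line on which all error terms are estimated, between the last exponent used and the first one omitted\<close>
  define x where "x = (Re (e (N - 1)) + Re (e N)) / 2"
  have x: "Re (e (N - 1)) < x" "x < Re (e N)" "0 < x"
    using e_less e_pos[of "N - 1"] by (auto simp: x_def)
  have x_gt: "Re (e n) < x" if "n < N" for n
  proof -
    have "n \<le> N - 1" using that by simp
    then show ?thesis by (rule le_less_trans[OF e_mono x(1)])
  qed
  obtain h v v' k k' where phase: "phase_coordinate h v v'"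
    and k: "continuous_on {0..h} k" "continuous_on {0..h} k'"
    and local: "\<And>s. 0 < s \<Longrightarrow> s < h \<Longrightarrow> (k has_vector_derivative k' s) (at s) \<and>
       t0 + \<sigma> * s \<in> segment t0 T \<and> \<psi> (t0 + \<sigma> * s) = v s powr \<beta> \<and>
       a (t0 + \<sigma> * s) = of_real \<sigma> * (of_real (v s) powr \<alpha> * of_real (v' s) *
         ((\<Sum>n<N. of_real \<beta> * d n * of_real (v s) ^ n) + of_real (v s) ^ N * k s))"
    using local_phase_coordinate[OF F T, of N] unfolding \<sigma>_def d_def by blast
  interpret phase_coordinate h v v' by (rule phase)
  obtain C where C: "C \<ge> 0" "\<And>F c E. Mellin_representation \<beta> F c E \<Longrightarrow> x < c \<Longrightarrow>
       continuous_on {0<..<h} E \<Longrightarrow> (\<And>s. 0 < s \<Longrightarrow> s < h \<Longrightarrow> cmod (E s) \<le> 1) \<Longrightarrow>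
     cmod ((LINT s:{0<..<h}|lborel. E s * (of_real (v s) powr \<alpha> * of_real (v' s) *
            ((\<Sum>n<N. of_real \<beta> * d n * of_real (v s) ^ n) + of_real (v s) ^ N * k s)))
         - (\<Sum>n<N. F (e n) * d n)) \<le> C * absolute_line_integral x F"
    using local_integral_expansion[where d = d, OF \<beta> \<alpha> e_eq x(3) x_gt x(2) k] local by blast
  \<comment> \<open>the short interval at the endpoint, as the image of the parameter interval\<close>
  define near where "near = (\<lambda>s. t0 + \<sigma> * s) ` {0<..<h}"
  define tail where "tail = segment t0 T - near"
  have \<sigma>: "\<bar>\<sigma>\<bar> = 1" "\<sigma> * \<sigma> = 1" using segment_sign_cases[of t0 T] by (auto simp: \<sigma>_def)
  have near_sub: "near \<subseteq> segment t0 T" using local by (auto simp: near_def)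
  have "near = ball t0 h \<inter> segment t0 T"
  proof safe
    fix t assume "t \<in> near"
    then show "t \<in> ball t0 h" "t \<in> segment t0 T"
      using near_sub \<sigma> by (auto simp: near_def dist_real_def abs_mult)
  next
    fix t assume t: "t \<in> ball t0 h" "t \<in> segment t0 T"
    have "t = t0 + \<sigma> * \<bar>t - t0\<bar>"
    proof -
      have "\<sigma> * \<bar>t - t0\<bar> = (\<sigma> * \<sigma>) * (t - t0)"
        unfolding segment_imp_sign(1)[OF t(2), symmetric] \<sigma>_def by (rule mult.assoc[symmetric])
      then show ?thesis unfolding \<sigma>(2) by simp
    qed
    moreover have "\<bar>t - t0\<bar> \<in> {0<..<h}"
      using t segment_imp_sign(2)[OF t(2)] by (auto simp: dist_real_def)
    ultimately show "t \<in> near" unfolding near_def by (rule image_eqI)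
  qed
  then have near_meas: "near \<in> sets borel" and tail_far: "\<And>t. t \<in> tail \<Longrightarrow> \<bar>t - t0\<bar> \<ge> h"
    by (auto simp: segment_measurable tail_def dist_real_def)
  have tail_meas: "tail \<in> sets borel" "tail \<subseteq> segment t0 T"
    using near_meas segment_measurable[of t0 T] by (auto simp: tail_def)
  obtain c where c: "c > \<phi>_t0" "\<And>t. t \<in> tail \<Longrightarrow> \<phi> t \<ge> c"
    using phase_gap[OF T \<phi>_cont assms(6) _ assms(9) h_pos] assms(8) tail_far tail_meas(2) by blast
  have "c > 0" using c(1) assms(7) by simp
  define L where "L l = (LINT t:segment t0 T|lborel. exp (- of_real (l * \<phi> t)) * a t)" for l
  define A where "A l = absolute_line_integral x (\<lambda>z. \<Phi> z l)" for l
  define M where "M = exp (l0 * c) * (LINT t:tail|lborel. exp (- l0 * \<phi> t) * cmod (a t))"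
  have A_nonneg: "A l \<ge> 0" for l
    unfolding A_def absolute_line_integral_def by (intro integral_nonneg_AE) auto
  have M_nonneg: "M \<ge> 0"
    unfolding M_def set_lebesgue_integral_def
    by (intro mult_nonneg_nonneg integral_nonneg_AE) auto
  have bound: "cmod (L l - (\<Sum>n<N. \<Phi> (e n) l * (of_real \<sigma> * d n))) \<le> C * A l + M * exp (- c * l)"
    if l: "l > 0" "l \<ge> l0" "x < \<zeta> l" for l
  proof -
    define E where "E s = exp (- complex_of_real (l * \<phi> (t0 + \<sigma> * s)))" for s
    define f where "f t = exp (- complex_of_real (l * \<phi> t)) * a t" for t
    have decay: "rapid_decay_in_strip (\<lambda>z. \<Phi> z l) 0 (\<zeta> l)"
      using K2[rule_format, OF l(1)] by (elim conjE) (rule rapid_decay_if_bigo)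
    have rep: "Mellin_representation \<beta> (\<lambda>z. \<Phi> z l) (\<zeta> l) E"
      unfolding Mellin_representation_def
    proof (intro conjI decay allI impI; elim conjE)
      fix x' s assume *: "0 < x'" "x' < \<zeta> l" "0 < s" "s < h"
      show "E s = 1 / (2 * of_real pi * \<i>) *
          vertical_line_integral x' (\<lambda>z. \<Phi> z l * of_real (v s) powr (- of_real \<beta> * z))"
        using Mellin[OF l(1) *(1,2), of "t0 + \<sigma> * s"] local[OF *(3,4)] v_pos[of s] *
        by (simp add: E_def complex_powr_powr)
    qed
    have "continuous_on {0<..<h} (\<lambda>s. \<phi> (t0 + \<sigma> * s))"
      using \<phi>_cont by (rule continuous_on_compose2) (use local in \<open>auto intro!: continuous_intros\<close>)
    then have E_cont: "continuous_on {0<..<h} E"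
      unfolding E_def by (intro continuous_intros)
    have f_int: "set_integrable lborel (segment t0 T) f"
      unfolding f_def using \<phi>_pos
      by (intro exponential_integral_integrable[OF segment_measurable \<phi>_cont a_cont _ int l(2)])
        (auto simp: less_imp_le)
    have "L l = (LINT t:near \<union> tail|lborel. f t)"
      using near_sub by (simp add: L_def f_def tail_def Un_absorb1)
    also have "\<dots> = (LINT t:near|lborel. f t) + (LINT t:tail|lborel. f t)"
      using near_sub tail_meas near_meas
      by (intro set_integral_Un set_integrable_subset[OF f_int]) (auto simp: tail_def)
    also have "(LINT t:near|lborel. f t) = (LINT s:{0<..<h}|lborel. of_real \<sigma> *
       (E s * (of_real (v s) powr \<alpha> * of_real (v' s) *
         ((\<Sum>n<N. of_real \<beta> * d n * of_real (v s) ^ n) + of_real (v s) ^ N * k s))))"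
      unfolding near_def integral_over_near_part[OF \<sigma>(1)]
    proof (rule set_lebesgue_integral_cong, simp, intro allI impI)
      fix s assume "s \<in> {0<..<h}"
      then have "a (t0 + \<sigma> * s) = of_real \<sigma> * (of_real (v s) powr \<alpha> * of_real (v' s) *
         ((\<Sum>n<N. of_real \<beta> * d n * of_real (v s) ^ n) + of_real (v s) ^ N * k s))"
        using local[of s] by simp
      then show "f (t0 + \<sigma> * s) = of_real \<sigma> * (E s * (of_real (v s) powr \<alpha> * of_real (v' s) *
         ((\<Sum>n<N. of_real \<beta> * d n * of_real (v s) ^ n) + of_real (v s) ^ N * k s)))"
        unfolding f_def E_def by (simp only: mult.left_commute)
    qed
    also have "\<dots> = of_real \<sigma> * (LINT s:{0<..<h}|lborel.
       E s * (of_real (v s) powr \<alpha> * of_real (v' s) *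
         ((\<Sum>n<N. of_real \<beta> * d n * of_real (v s) ^ n) + of_real (v s) ^ N * k s)))" (is "_ = _ * ?I")
      by (rule set_integral_mult_right)
    finally have L_eq: "L l = of_real \<sigma> * ?I + (LINT t:tail|lborel. f t)" .
    have "(\<Sum>n<N. \<Phi> (e n) l * (of_real \<sigma> * d n)) = of_real \<sigma> * (\<Sum>n<N. \<Phi> (e n) l * d n)"
      unfolding sum_distrib_left by (simp only: mult.left_commute)
    then have diff: "L l - (\<Sum>n<N. \<Phi> (e n) l * (of_real \<sigma> * d n)) =
        of_real \<sigma> * (?I - (\<Sum>n<N. \<Phi> (e n) l * d n)) + (LINT t:tail|lborel. f t)"
      unfolding L_eq by (simp only: right_diff_distrib diff_add_eq)
    have unit: "cmod (of_real \<sigma> * (?I - (\<Sum>n<N. \<Phi> (e n) l * d n))) = cmod (?I - (\<Sum>n<N. \<Phi> (e n) l * d n))"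
      unfolding norm_mult norm_of_real \<sigma>(1) by (rule mult_1)
    have "cmod (L l - (\<Sum>n<N. \<Phi> (e n) l * (of_real \<sigma> * d n)))
       \<le> cmod (?I - (\<Sum>n<N. \<Phi> (e n) l * d n)) + cmod (LINT t:tail|lborel. f t)"
      unfolding diff unit[symmetric] by (rule norm_triangle_ineq)
    also have "\<dots> \<le> C * A l + M * exp (- c * l)"
    proof (rule add_mono)
      show "cmod (?I - (\<Sum>n<N. \<Phi> (e n) l * d n)) \<le> C * A l"
        unfolding A_def using rep l(3) E_cont
      proof (rule C(2))
        show "cmod (E s) \<le> 1" if "0 < s" "s < h" for s
          using \<phi>_pos[of "t0 + \<sigma> * s"] local[OF that] l(1) by (simp add: E_def)
      qed
      show "cmod (LINT t:tail|lborel. f t) \<le> M * exp (- c * l)"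
        unfolding f_def M_def using \<phi>_pos
        by (intro tail_integral_bound[OF segment_measurable \<phi>_cont a_cont _ int l(2) tail_meas c(2)])
          (auto simp: less_imp_le)
    qed
    finally show ?thesis .
  qed
  have "(\<lambda>l. L l - (\<Sum>n<N. \<Phi> (e n) l * (of_real \<sigma> * d n)))
      \<in> O[at_top](\<lambda>l. of_real (C * A l + M * exp (- c * l)))"
  proof (rule landau_o.bigI[of 1])
    have "\<forall>\<^sub>F l in at_top. l > 0 \<and> l \<ge> l0 \<and> x < \<zeta> l"
      using \<zeta> by (intro eventually_conj eventually_gt_at_top eventually_ge_at_top)
        (auto simp: filterlim_at_top_dense)
    then show "\<forall>\<^sub>F l in at_top. norm (L l - (\<Sum>n<N. \<Phi> (e n) l * (of_real \<sigma> * d n)))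
        \<le> 1 * norm (complex_of_real (C * A l + M * exp (- c * l)))"
    proof eventually_elim
      case (elim l)
      then have "cmod (L l - (\<Sum>n<N. \<Phi> (e n) l * (of_real \<sigma> * d n))) \<le> C * A l + M * exp (- c * l)"
        using bound by blast
      then show ?case
        unfolding norm_of_real mult_1 by (rule order_trans[OF _ abs_ge_self])
    qed
  qed simp
  moreover have "(\<lambda>l. of_real (C * A l + M * exp (- c * l))) \<in> o[at_top](\<lambda>l. \<Phi> (e (N - 1)) l)"
  proof -
    have "(\<lambda>l. complex_of_real (A l)) \<in> o[at_top](\<lambda>l. \<Phi> (e (N - 1)) l)"
      unfolding A_def absolute_line_integral_def using K4[rule_format, OF x(3)]
      by (rule landau_o.big_small_trans) (rule \<Phi>_scale[OF e_pos], use x(1) in simp)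
    moreover have "(\<lambda>l. complex_of_real (exp (- c * l))) \<in> o[at_top](\<lambda>l. \<Phi> (e (N - 1)) l)"
      by (rule K5[rule_format, OF \<open>c > 0\<close> e_pos])
    ultimately show ?thesis
      unfolding of_real_add of_real_mult
      by (intro sum_in_smallo) (simp_all only: cmult_in_smallo_iff simp_thms)
  qed
  ultimately have "(\<lambda>l. L l - (\<Sum>n<N. \<Phi> (e n) l * (of_real \<sigma> * d n))) \<in> o[at_top](\<lambda>l. \<Phi> (e (N - 1)) l)"
    by (rule landau_o.big_small_trans)
  then show "(\<lambda>l. (LINT t:segment t0 T|lborel. exp (- of_real (l * \<phi> t)) * a t) -
      (\<Sum>n<N. \<Phi> (chi_exponent \<alpha> \<beta> n) l *
         (exp (\<i> * of_real (segment_arg t0 T)) * segment_coeff t0 T \<alpha> \<beta> q p n)))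
     \<in> o[at_top](\<lambda>l. \<Phi> (chi_exponent \<alpha> \<beta> (N - 1)) l)"
    by (simp only: L_def e_def d_def \<sigma>_def segment_sign_eq)
qed

end
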